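(* Let $s,w$ be nonnegative nondecreasing functions on $(0,\infty)$, with $s$ locally integrable on $\mathbb{R}_+$. Let $K$ be a continuous kernel on $(0,\infty)\times(0,\infty)$ satisfying $$K(x,y)\asymp\min\big\{1,(s(x)w(y))^{-1/2}\big\},\qquad x,y>0,$$ and put $Ff(y)=\int_0^\infty s(x)f(x)K(x,y)\,dx$, $y>0$, for $f$ as described in the context. Let $1<p\le q<\infty$, $1\le a\le\infty$, and let $u,v$ be nonnegative functions on $(0,\infty)$ such that $uw^{q/a'}$ and $v^{1-p'}s^{p'/a'}$ are locally integrable on $\mathbb{R}_+$. Then the inequality $$\Vert w^{1/a'}Ff\Vert_{q,u}\lesssim\Vert s^{1/a}f\Vert_{p,v}$$ holds for every measurable $f$ (with a constant independent of $f$) if and only if there exists $C>0$ such that both $$\sup_{r>0}\bigg(\int_0^{1/r}u(y)w(y)^{q/a'}\,dy\bigg)^{1/q}\bigg(\int_0^r v(x)^{1-p'}s(x)^{p'/a'}\,dx\bigg)^{1/p'}\le C$$ and $$\sup_{r>0}\bigg(\int_{1/r}^\infty u(y)w(y)^{q(1/a'-1/2)}\,dy\bigg)^{1/q}\bigg(\int_r^\infty v(x)^{1-p'}s(x)^{p'(1/a'-1/2)}\,dx\bigg)^{1/p'}\le C$$ hold.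
   Context: Notation: for $0<p<\infty$ and a nonnegative measurable function $v$ on $(0,\infty)$, $\Vert f\Vert_{p,v}=\big(\int_0^\infty v(x)|f(x)|^p\,dx\big)^{1/p}$ (possibly $+\infty$). For $1\le a\le\infty$, $a'=a/(a-1)$ is the dual exponent ($1/a+1/a'=1$, with $1/\infty=0$); likewise $p'$ is the dual exponent of $p$. $A\lesssim B$ means $A\le cB$ with a constant $c>0$ independent of the essential variables ($x,y,f$); $A\asymp B$ means $A\lesssim B\lesssim A$. Functions $f$: $f$ is a complex-valued measurable function on $(0,\infty)$, locally integrable on $\mathbb{R}_+$, satisfying $\int_0^1 s(x)|f(x)|\,dx+\int_1^\infty s(x)^{1/2}|f(x)|\,dx<\infty$, the paper's standing condition for $Ff(y)$ to be defined pointwise on $(0,\infty)$.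
   Formalization: The formal statement additionally assumes s(x)w(1/x) ≍ 1 for x>0 (so s,w>0); without it the equivalence fails, e.g. s=x, w=y², K=min{1,x^{-1/2}y^{-1}}, p=q=2, a=1, u=1, v=x^{1/2}: the inequality holds but the first supremum is infinite. *)

theory Defs
  imports "HOL-Analysis.Analysis"
begin

(* Real powers on [0, \<infinity>].  The library's powr on the reals has 0 powr r = 0 for every r, which
   would be wrong for expressions such as v powr (1 - p') at zeros of v; here 0 to a negative
   power is \<infinity>.  Products use the ennreal convention 0 * \<infinity> = 0. *)
definition epowr :: "ennreal \<Rightarrow> real \<Rightarrow> ennreal" (infixr \<open>epowr\<close> 80) where
  "x epowr r =
     (if r = 0 then 1
      else if x = 0 then (if r > 0 then 0 else \<infinity>)
      else if x = \<infinity> then (if r > 0 then \<infinity> else 0)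
      else ennreal (enn2real x powr r))"

(* The real number 1/a for an exponent a in [1, \<infinity>], with 1/\<infinity> = 0. *)
definition rec_exp :: "ennreal \<Rightarrow> real" where
  "rec_exp a = enn2real (1 / a)"

definition comparable_on :: "'a set \<Rightarrow> ('a \<Rightarrow> real) \<Rightarrow> ('a \<Rightarrow> real) \<Rightarrow> bool" where
  "comparable_on S A B \<longleftrightarrow> (\<exists>c>0. \<exists>C>0. \<forall>z\<in>S. c * B z \<le> A z \<and> A z \<le> C * B z)"

(* Local integrability on \<real>\<^sub>+ = [0, \<infinity>) of functions defined on (0, \<infinity>):
   integrability up to the origin, on every (0, b]. *)
definition loc_integrable :: "(real \<Rightarrow> 'a::{banach, second_countable_topology}) \<Rightarrow> bool" where
  "loc_integrable f \<longleftrightarrow> (\<forall>b>0. set_integrable lebesgue {0<..b} f)"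

(* The same for nonnegative functions that may take the value \<infinity>. *)
definition nn_loc_integrable :: "(real \<Rightarrow> ennreal) \<Rightarrow> bool" where
  "nn_loc_integrable g \<longleftrightarrow>
     g \<in> borel_measurable (lebesgue_on {0<..}) \<and>
     (\<forall>b>0. (\<integral>\<^sup>+x\<in>{0<..b}. g x \<partial>lebesgue) < \<infinity>)"

definition wnorm :: "real \<Rightarrow> (real \<Rightarrow> real) \<Rightarrow> (real \<Rightarrow> complex) \<Rightarrow> ennreal" where
  "wnorm p v f =
     (\<integral>\<^sup>+x\<in>{0<..}. ennreal (v x) * ennreal (cmod (f x)) epowr p \<partial>lebesgue) epowr (1 / p)"

definition transform ::
  "(real \<Rightarrow> real) \<Rightarrow> (real \<Rightarrow> real \<Rightarrow> real) \<Rightarrow> (real \<Rightarrow> complex) \<Rightarrow> real \<Rightarrow> complex" where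
  "transform s K f y =
     set_lebesgue_integral lebesgue {0<..} (\<lambda>x. of_real (s x) * f x * of_real (K x y))"

definition admissible :: "(real \<Rightarrow> real) \<Rightarrow> (real \<Rightarrow> complex) \<Rightarrow> bool" where
  "admissible s f \<longleftrightarrow>
     f \<in> borel_measurable (lebesgue_on {0<..}) \<and>
     loc_integrable f \<and>
     (\<integral>\<^sup>+x\<in>{0<..1}. ennreal (s x * cmod (f x)) \<partial>lebesgue)
       + (\<integral>\<^sup>+x\<in>{1<..}. ennreal (sqrt (s x) * cmod (f x)) \<partial>lebesgue) < \<infinity>"

end

theory Submission
  imports Defs
begin

text \<open>
  The inequality reduces to two weighted Hardy inequalities. Since \<open>s x * w (1 / x)\<close> is comparable to
  \<open>1\<close> and \<open>w\<close> is nondecreasing, the kernel is comparable to \<open>1\<close> for \<open>x * y \<le> 1\<close> and to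
  \<open>(s x * w y)^(-1/2)\<close> for \<open>x * y \<ge> 1\<close> (\<open>kernel_two_regimes\<close>). Hence the transform of \<open>f\<close> is at most a
  constant times the sum of the integral of \<open>s |f|\<close> over \<open>x \<le> 1 / y\<close> and \<open>w(y)^(-1/2)\<close> times the
  integral of \<open>s^(1/2) |f|\<close> over \<open>x \<ge> 1 / y\<close>. These are a Hardy operator and a dual Hardy operator
  applied to \<open>s^(1/a) |f|\<close>, with the weights \<open>s^(1/a')\<close>, \<open>w^(1/a')\<close> and \<open>s^(1/a' - 1/2)\<close>,
  \<open>w^(1/a' - 1/2)\<close>. The two suprema are exactly their Muckenhoupt conditions.

  Sufficiency is thus \<open>weighted_Hardy_inequality\<close>. It is proved by decomposing into the dyadic level
  sets of the Hardy operator: on each level Hoelder's inequality and the condition give the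
  estimate, and the levels are summed with \<open>p \<le> q\<close>. The argument is carried
  out for arbitrary measures compared through real keys, so it covers both operators at once.

  For necessity, \<open>K\<close> is nonnegative, so for nonnegative \<open>f\<close> the transform is bounded below, up to
  a constant, by either of the two operators. Testing on the function for which Hoelder's inequality is an equality
  (\<open>test_function_bound\<close>), cut off to intervals away from \<open>0\<close> and \<open>\<infinity>\<close>, yields the conditions on
  these intervals, and monotone convergence extends them to the half-lines.
\<close>

section \<open>Real powers on the extended half-line\<close>

lemma epowr_ennreal: "x > 0 \<Longrightarrow> ennreal x epowr r = ennreal (x powr r)"
  by (simp add: epowr_def)

lemma epowr_ennreal_pos_exponent: "r > 0 \<Longrightarrow> x \<ge> 0 \<Longrightarrow> ennreal x epowr r = ennreal (x powr r)"
  by (cases "x = 0") (simp_all add: epowr_def)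

lemma epowr_simps [simp]:
  "x epowr 0 = 1" "x epowr 1 = x" "r > 0 \<Longrightarrow> 0 epowr r = 0" "r > 0 \<Longrightarrow> \<infinity> epowr r = \<infinity>"
  "r > 0 \<Longrightarrow> top epowr r = top"
  by (simp_all add: epowr_def)
     (metis ennreal_enn2real_if enn2real_nonneg infinity_ennreal_def powr_one)

lemma epowr_mono:
  assumes "r \<ge> 0" "x \<le> y" shows "x epowr r \<le> y epowr r"
proof (cases "r = 0")
  case False
  with assms have "r > 0" by simp
  then show ?thesis using assms
    by (cases x; cases y) (auto simp: epowr_ennreal_pos_exponent powr_mono2 top_unique)
qed simp

lemma epowr_mult:
  assumes "r \<ge> 0" shows "(x * y) epowr r = x epowr r * y epowr r"
proof (cases "r = 0")
  case False
  with assms have "r > 0" by simp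
  then show ?thesis
    by (cases x; cases y)
       (auto simp: epowr_ennreal_pos_exponent ennreal_mult[symmetric] powr_mult ennreal_mult_top ennreal_top_mult)
qed simp

lemma epowr_epowr:
  assumes "r > 0" "t > 0" shows "(x epowr r) epowr t = x epowr (r * t)"
  using assms by (cases x) (auto simp: epowr_ennreal_pos_exponent powr_powr)

lemma epowr_add:
  assumes "r \<ge> 0" "t \<ge> 0" shows "x epowr (r + t) = x epowr r * x epowr t"
proof (cases "r = 0 \<or> t = 0")
  case False
  with assms have "r > 0" "t > 0" by simp_all
  then show ?thesis
    by (cases x) (auto simp: epowr_ennreal_pos_exponent powr_add ennreal_mult[symmetric])
qed auto

lemma epowr_eq_0_iff: "r > 0 \<Longrightarrow> x epowr r = 0 \<longleftrightarrow> x = 0"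
  by (cases x) (auto simp: epowr_ennreal_pos_exponent)

lemma epowr_eq_top_iff: "r > 0 \<Longrightarrow> x epowr r = \<infinity> \<longleftrightarrow> x = \<infinity>"
  by (cases x) (auto simp: epowr_ennreal_pos_exponent)

lemma epowr_le_iff:
  assumes "r > 0" shows "x epowr r \<le> y epowr r \<longleftrightarrow> x \<le> y"
proof
  assume "x epowr r \<le> y epowr r"
  then have "(x epowr r) epowr (1/r) \<le> (y epowr r) epowr (1/r)"
    using assms by (intro epowr_mono[of "1/r"]) auto
  moreover have "(z epowr r) epowr (1/r) = z" for z
    using assms epowr_epowr[of r "1/r" z] by simp
  ultimately show "x \<le> y" by simp
qed (use assms in \<open>simp add: epowr_mono\<close>)

lemma epowr_add_le:
  assumes "r \<ge> 0" shows "(x + y) epowr r \<le> 2 epowr r * (x epowr r + y epowr r)"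
proof -
  have "(x + y) epowr r \<le> (2 * max x y) epowr r"
    using assms by (intro epowr_mono) (auto simp: max_def mult_2 intro: add_mono)
  also have "\<dots> = 2 epowr r * (max x y) epowr r" using assms by (simp add: epowr_mult)
  also have "(max x y) epowr r \<le> x epowr r + y epowr r"
    by (auto simp: max_def)
  finally show ?thesis by (simp add: mult_left_mono)
qed

lemma measurable_epowr [measurable]:
  assumes [measurable]: "f \<in> borel_measurable M"
  shows "(\<lambda>x. f x epowr r) \<in> borel_measurable M"
  unfolding epowr_def by measurable

text \<open>This is where \<open>p \<le> q\<close> enters: with \<open>r = q / p\<close>, contributions of separate dyadic levels,
  each raised to the power \<open>r\<close>, can be added up. Writing \<open>S\<close> for the sum of the \<open>a n\<close>, each term
  satisfies \<open>a n epowr r = a n epowr (r - 1) * a n \<le> S epowr (r - 1) * a n\<close>.\<close>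
lemma suminf_epowr_le:
  fixes a :: "nat \<Rightarrow> ennreal"
  assumes "1 \<le> r" shows "(\<Sum>n. a n epowr r) \<le> (\<Sum>n. a n) epowr r"
proof -
  let ?S = "\<Sum>n. a n"
  have split: "x epowr r = x epowr (r - 1) * x" for x
    using assms epowr_add[of "r - 1" 1 x] by simp
  have "(\<Sum>n. a n epowr r) \<le> (\<Sum>n. ?S epowr (r - 1) * a n)"
  proof (intro suminf_le summableI)
    fix n
    have "a n \<le> ?S" using sum_le_suminf[OF summableI, of "{n}" a] by simp
    then show "a n epowr r \<le> ?S epowr (r - 1) * a n"
      unfolding split using assms by (intro mult_right_mono epowr_mono) auto
  qed
  also have "\<dots> = ?S epowr r" by (simp add: split)
  finally show ?thesis .
qed

section \<open>Hoelder's inequality\<close>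

text \<open>When a factor is infinite the right-hand side is infinite too, so the real inequality
  extends to all of \<open>[0, \<infinity>]\<close>.\<close>
lemma ennreal_Youngs_inequality:
  assumes "1 < p" "1 < p'" "1 / p + 1 / p' = 1"
  shows "x * y \<le> ennreal (1 / p) * x epowr p + ennreal (1 / p') * y epowr p'"
proof (cases "x = \<infinity> \<or> y = \<infinity>")
  case True
  with assms show ?thesis by (auto simp: ennreal_mult_top)
next
  case False
  then obtain a b where ab: "x = ennreal a" "a \<ge> 0" "y = ennreal b" "b \<ge> 0"
    by (cases x; cases y) auto
  with Youngs_inequality[of p p' a b] assms show ?thesis
    by (simp add: epowr_ennreal_pos_exponent flip: ennreal_mult ennreal_plus)
qed

text \<open>The classical argument: normalise both factors and integrate Young's inequality. The
  degenerate cases are settled first. If one norm vanishes, the integrand is zero almost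
  everywhere, which agrees with the convention \<open>0 * \<infinity> = 0\<close>.\<close>
lemma nn_integral_Hoelder:
  assumes p: "1 < p" "1 < p'" "1 / p + 1 / p' = 1"
    and [measurable]: "g \<in> borel_measurable M" "k \<in> borel_measurable M"
  shows "(\<integral>\<^sup>+x. g x * k x \<partial>M)
    \<le> (\<integral>\<^sup>+x. g x epowr p \<partial>M) epowr (1 / p) * (\<integral>\<^sup>+x. k x epowr p' \<partial>M) epowr (1 / p')"
    (is "?L \<le> ?A epowr _ * ?B epowr _")
proof -
  consider "?A = 0 \<or> ?B = 0" | "?A \<noteq> 0" "?B \<noteq> 0" "?A = \<infinity> \<or> ?B = \<infinity>"
    | "?A \<noteq> 0" "?B \<noteq> 0" "?A \<noteq> \<infinity>" "?B \<noteq> \<infinity>" by blast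
  then show ?thesis
  proof cases
    case 1
    then have "AE x in M. g x * k x = 0"
    proof
      assume "?A = 0"
      then have "AE x in M. g x epowr p = 0" by (subst (asm) nn_integral_0_iff_AE) auto
      then show ?thesis by eventually_elim (use p in \<open>simp add: epowr_eq_0_iff\<close>)
    next
      assume "?B = 0"
      then have "AE x in M. k x epowr p' = 0" by (subst (asm) nn_integral_0_iff_AE) auto
      then show ?thesis by eventually_elim (use p in \<open>simp add: epowr_eq_0_iff\<close>)
    qed
    then have "?L = 0" by (subst nn_integral_0_iff_AE) auto
    then show ?thesis by simp
  next
    case 2
    with p have "?A epowr (1/p) * ?B epowr (1/p') = \<infinity>"
      by (auto simp: epowr_eq_0_iff ennreal_mult_eq_top_iff epowr_eq_top_iff)
    then show ?thesis by simp
  next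
    case 3
    then obtain A where A: "?A = ennreal A" "A > 0"
      by (cases ?A) (auto simp: order_less_le)
    from 3 obtain B where B: "?B = ennreal B" "B > 0"
      by (cases ?B) (auto simp: order_less_le)
    define \<alpha> where "\<alpha> = A powr (1 / p)"
    define \<beta> where "\<beta> = B powr (1 / p')"
    have pos: "\<alpha> > 0" "\<beta> > 0" using A B by (auto simp: \<alpha>_def \<beta>_def)
    have pw: "ennreal (1/\<alpha>) epowr p = ennreal (1/A)" "ennreal (1/\<beta>) epowr p' = ennreal (1/B)"
      using A B p by (auto simp: epowr_ennreal \<alpha>_def \<beta>_def powr_divide powr_powr)
    have "ennreal (1/\<alpha>) * ennreal (1/\<beta>) * ?L
        = (\<integral>\<^sup>+x. (ennreal (1/\<alpha>) * g x) * (ennreal (1/\<beta>) * k x) \<partial>M)"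
      by (subst nn_integral_cmult[symmetric]) (auto simp: ac_simps)
    also have "\<dots> \<le> (\<integral>\<^sup>+x. ennreal (1/p) * (ennreal (1/A) * g x epowr p)
        + ennreal (1/p') * (ennreal (1/B) * k x epowr p') \<partial>M)"
      using p by (intro nn_integral_mono order_trans[OF ennreal_Youngs_inequality[OF p]])
        (simp add: epowr_mult pw)
    also have "\<dots> = ennreal (1/p) * (ennreal (1/A) * ?A) + ennreal (1/p') * (ennreal (1/B) * ?B)"
      by (simp add: nn_integral_add nn_integral_cmult)
    also have "\<dots> = 1"
      using A B p by (simp flip: ennreal_mult ennreal_plus)
    finally have *: "ennreal (1/\<alpha>) * ennreal (1/\<beta>) * ?L \<le> 1" .
    have "?L = ennreal (\<alpha> * \<beta>) * (ennreal (1/\<alpha>) * ennreal (1/\<beta>) * ?L)"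
      using pos by (simp flip: ennreal_mult mult.assoc)
    also have "\<dots> \<le> ennreal (\<alpha> * \<beta>) * 1" using * by (intro mult_left_mono) auto
    also have "\<dots> = ?A epowr (1/p) * ?B epowr (1/p')"
      using A B by (simp add: \<alpha>_def \<beta>_def epowr_ennreal ennreal_mult)
    finally show ?thesis .
  qed
qed

section \<open>The weighted Hardy inequality for general measures\<close>

text \<open>Exhaustion by upper parts. If \<open>\<eta>\<close> attains its infimum on \<open>E\<close>, the upper part of a
  minimiser is \<open>E\<close> itself; otherwise the upper parts of a minimising sequence increase to \<open>E\<close>.
  The lemma measures a level set through its points alone, whether or not its endpoints belong
  to it or carry mass.\<close>
lemma emeasure_le_if_upper_parts_le:
  fixes \<eta> :: "'b \<Rightarrow> real"
  assumes [measurable]: "\<eta> \<in> borel_measurable N" "E \<in> sets N"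
    and le: "\<And>y. y \<in> E \<Longrightarrow> emeasure N {z \<in> E. \<eta> y \<le> \<eta> z} \<le> B"
  shows "emeasure N E \<le> B"
proof (cases "\<exists>y\<in>E. \<forall>z\<in>E. \<eta> y \<le> \<eta> z")
  case True
  then obtain y where "y \<in> E" "{z \<in> E. \<eta> y \<le> \<eta> z} = E" by auto
  with le[of y] show ?thesis by simp
next
  case no_min: False
  show ?thesis
  proof (cases "E = {}")
    case False
    obtain h :: "nat \<Rightarrow> ereal" where h: "decseq h" "range h \<subseteq> (\<lambda>y. ereal (\<eta> y)) ` E"
        "(INF y\<in>E. ereal (\<eta> y)) = (INF i. h i)"
      using Inf_countable_INF[of "(\<lambda>y. ereal (\<eta> y)) ` E"] False by auto
    define U where "U i = {z \<in> E. h i \<le> ereal (\<eta> z)}" for i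
    have U_sets: "U i \<in> sets N" for i
    proof -
      have "U i = {z \<in> space N. h i \<le> ereal (\<eta> z)} \<inter> E"
        using sets.sets_into_space[OF assms(2)] by (auto simp: U_def)
      then show ?thesis by simp
    qed
    have inc: "incseq U"
      using h(1) by (auto simp: incseq_def decseq_def U_def intro: order_trans)
    have "z \<in> (\<Union>i. U i)" if z: "z \<in> E" for z
    proof -
      obtain y where y: "y \<in> E" "\<eta> y < \<eta> z" using no_min z by (metis not_less)
      then have "(INF i. h i) < ereal (\<eta> z)"
        unfolding h(3)[symmetric] by (meson INF_lower2 less_ereal.simps(1) nless_le order_less_le_trans INF_less_iff)
      then obtain i where "h i < ereal (\<eta> z)" by (auto simp: INF_less_iff)
      with z show ?thesis by (auto simp: U_def intro!: exI[of _ i])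
    qed
    then have "E = (\<Union>i. U i)" by (auto simp: U_def)
    then have "emeasure N E = (SUP i. emeasure N (U i))"
      using SUP_emeasure_incseq[of U N] inc U_sets by (auto simp: image_subset_iff)
    also have "\<dots> \<le> B"
    proof (rule SUP_least)
      fix i
      obtain y where "y \<in> E" "h i = ereal (\<eta> y)" using h(2) by auto
      with le[of y] show "emeasure N (U i) \<le> B" by (simp add: U_def)
    qed
    finally show ?thesis .
  qed simp
qed

text \<open>The sublevel sets of a monotone function are intervals.\<close>
lemma borel_measurable_mono_ennreal:
  fixes G :: "real \<Rightarrow> ennreal"
  assumes "mono G" shows "G \<in> borel_measurable borel"
proof (rule borel_measurableI_le)
  fix c
  let ?S = "{t. G t \<le> c}"
  have down: "t \<in> ?S" if "t' \<in> ?S" "t \<le> t'" for t t'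
    using monoD[OF assms that(2)] that(1) by auto
  have "is_interval ?S"
    using down by (auto simp: is_interval_1)
  then have "?S \<in> sets borel" by (rule real_interval_borel_measurable)
  then show "{t \<in> space borel. G t \<le> c} \<in> sets borel" by simp
qed

lemma borel_measurable_integral_up_to:
  fixes \<xi> :: "'a \<Rightarrow> real" and \<eta> :: "'b \<Rightarrow> real"
  assumes "\<eta> \<in> borel_measurable N"
  shows "(\<lambda>y. \<integral>\<^sup>+x\<in>{x. \<xi> x \<le> \<eta> y}. h x \<partial>M) \<in> borel_measurable N"
proof -
  have "mono (\<lambda>t. \<integral>\<^sup>+x\<in>{x. \<xi> x \<le> t}. h x \<partial>M)"
    by (intro monoI nn_integral_mono mult_left_mono) (auto split: split_indicator)
  from measurable_compose[OF assms borel_measurable_mono_ennreal[OF this]] show ?thesis .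
qed

lemma ennreal_dyadic_cover:
  assumes "0 < x" "x < \<infinity>"
  shows "\<exists>k::int. ennreal (2 powr k) < x \<and> x \<le> ennreal (2 powr (k + 1))"
proof -
  from assms obtain z where z: "x = ennreal z" "z > 0" by (cases x) auto
  define k where "k = \<lceil>log 2 z\<rceil> - 1"
  have "real_of_int k < log 2 z" "log 2 z \<le> k + 1" unfolding k_def by linarith+
  then have "2 powr k < z" "z \<le> 2 powr (k + 1)"
    using z by (simp_all add: less_log_iff log_le_iff)
  then show ?thesis using z by (auto intro!: exI[of _ k] simp: ennreal_less_iff)
qed

text \<open>The weighted Hardy inequality, for measures on two spaces whose points are compared through
  real keys \<open>\<xi>\<close> and \<open>\<eta>\<close>; choosing the keys gives the operator of integration up to \<open>1 / y\<close> as
  well as its dual, integration from \<open>1 / y\<close> on. The weight on the \<open>x\<close> side is split between \<open>g\<close> and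
  \<open>k\<close>, so that the hypothesis is the usual Muckenhoupt condition for \<open>k epowr p'\<close> and \<open>N\<close>, raised to
  the power \<open>q\<close>.

  Put \<open>G t\<close> for the integral of \<open>g * k\<close> over \<open>\<xi> \<le> t\<close> and let \<open>E j\<close> be the set of \<open>y\<close> with
  \<open>2^j < G (\<eta> y) \<le> 2^(j+1)\<close>. The part of that integral carried by points \<open>x\<close> with
  \<open>G (\<xi> x) \<le> 2^(j-1)\<close> is at most \<open>2^(j-1)\<close>, so at least \<open>2^(j-1)\<close> is left for the points with
  \<open>2^(j-1) < G (\<xi> x) \<le> 2^(j+1)\<close>. Hoelder's inequality on these points and the hypothesis bound, up to a
  constant, the contribution of \<open>E j\<close> by the power \<open>q / p\<close> of the integral of \<open>g epowr p\<close> over them. Each \<open>x\<close>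
  lies in at most two of these sets, and \<open>q / p \<ge> 1\<close> allows summation over \<open>j\<close>.\<close>
lemma weighted_Hardy_inequality:
  fixes M :: "'a measure" and N :: "'b measure" and \<xi> :: "'a \<Rightarrow> real" and \<eta> :: "'b \<Rightarrow> real"
    and g k :: "'a \<Rightarrow> ennreal"
  assumes p: "1 < p" "1 / p + 1 / p' = 1" and q: "p \<le> q"
    and [measurable]: "\<xi> \<in> borel_measurable M" "\<eta> \<in> borel_measurable N"
      "g \<in> borel_measurable M" "k \<in> borel_measurable M"
    and B: "0 < B" "B < \<infinity>"
    and cond: "\<And>y. y \<in> space N \<Longrightarrow>
      (\<integral>\<^sup>+x\<in>{x. \<xi> x \<le> \<eta> y}. k x epowr p' \<partial>M) epowr (q / p') * emeasure N {z \<in> space N. \<eta> y \<le> \<eta> z} \<le> B"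
  shows "(\<integral>\<^sup>+y. (\<integral>\<^sup>+x\<in>{x. \<xi> x \<le> \<eta> y}. g x * k x \<partial>M) epowr q \<partial>N)
    \<le> 4 epowr q * 2 epowr (q / p) * B * (\<integral>\<^sup>+x. g x epowr p \<partial>M) epowr (q / p)"
    (is "?L \<le> _ * ?I epowr _")
proof (cases "?I = \<infinity>")
  case True
  have "0 < q" "0 < p" using p q by auto
  then have "4 epowr q * 2 epowr (q / p) * B * ?I epowr (q/p) = \<infinity>"
    using B True by (simp add: ennreal_mult_eq_top_iff epowr_eq_0_iff)
  then show ?thesis by simp
next
  case I_fin: False
  have p': "1 < p'" and pos: "0 < p" "0 < q" "0 < p'"
  proof -
    show "1 < p'"
    proof -
      have "1/p < 1" "0 < 1/p" using p by auto
      then have *: "0 < 1/p'" "1/p' < 1" using p by linarith+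
      then show ?thesis by (simp add: divide_less_eq split: if_splits)
    qed
    then show "0 < p'" by simp
  qed (use p q in auto)
  define G where "G t = (\<integral>\<^sup>+x\<in>{x. \<xi> x \<le> t}. g x * k x \<partial>M)" for t
  define S where "S t = (\<integral>\<^sup>+x\<in>{x. \<xi> x \<le> t}. k x epowr p' \<partial>M)" for t
  define U where "U t = emeasure N {z \<in> space N. t \<le> \<eta> z}" for t
  have condition: "S (\<eta> y) epowr (q / p') * U (\<eta> y) \<le> B" if "y \<in> space N" for y
    using cond[OF that] by (simp add: S_def U_def)
  have mono_G: "mono G"
    unfolding G_def by (intro monoI nn_integral_mono mult_left_mono) (auto split: split_indicator)
  note [measurable] = borel_measurable_mono_ennreal[OF mono_G]
  have Hoelder_on: "(\<integral>\<^sup>+x\<in>{x. \<xi> x \<le> t}. g x * k x * indicator D x \<partial>M)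
      \<le> (\<integral>\<^sup>+x\<in>D. g x epowr p \<partial>M) epowr (1/p) * S t epowr (1/p')"
    if [measurable]: "D \<in> sets M" for t D
  proof -
    have "(\<integral>\<^sup>+x\<in>{x. \<xi> x \<le> t}. g x * k x * indicator D x \<partial>M)
       = (\<integral>\<^sup>+x. (g x * indicator D x) * (k x * indicator {x. \<xi> x \<le> t} x) \<partial>M)"
      by (simp add: ac_simps)
    also have "\<dots> \<le> (\<integral>\<^sup>+x. (g x * indicator D x) epowr p \<partial>M) epowr (1/p)
        * (\<integral>\<^sup>+x. (k x * indicator {x. \<xi> x \<le> t} x) epowr p' \<partial>M) epowr (1/p')"
      using p p' by (intro nn_integral_Hoelder) auto
    also have "(\<integral>\<^sup>+x. (g x * indicator D x) epowr p \<partial>M) = (\<integral>\<^sup>+x\<in>D. g x epowr p \<partial>M)"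
      using pos by (intro nn_integral_cong) (auto split: split_indicator)
    also have "(\<integral>\<^sup>+x. (k x * indicator {x. \<xi> x \<le> t} x) epowr p' \<partial>M) = S t"
      unfolding S_def using pos by (intro nn_integral_cong) (auto split: split_indicator)
    finally show ?thesis .
  qed
  \<comment> \<open>The points \<open>x\<close> with \<open>G (\<xi> x) \<le> c\<close> form an initial segment, exhausted by the
      segments up to the keys of its own points, each of mass at most \<open>c\<close>.\<close>
  have low_part: "(\<integral>\<^sup>+x. g x * k x * indicator {x \<in> space M. G (\<xi> x) \<le> c} x \<partial>M) \<le> c" for c
  proof -
    let ?\<mu> = "density M (\<lambda>x. g x * k x)" and ?E = "{x \<in> space M. G (\<xi> x) \<le> c}"
    have "emeasure ?\<mu> ?E \<le> c"
    proof (rule emeasure_le_if_upper_parts_le[where \<eta> = "\<lambda>x. - \<xi> x"])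
      fix y assume y: "y \<in> ?E"
      have "emeasure ?\<mu> {z \<in> ?E. - \<xi> y \<le> - \<xi> z}
          = (\<integral>\<^sup>+x\<in>{z \<in> ?E. - \<xi> y \<le> - \<xi> z}. g x * k x \<partial>M)"
        by (rule emeasure_density) auto
      also have "\<dots> \<le> G (\<xi> y)"
        unfolding G_def by (intro nn_integral_mono mult_left_mono) (auto split: split_indicator)
      also have "\<dots> \<le> c" using y by simp
      finally show "emeasure ?\<mu> {z \<in> ?E. - \<xi> y \<le> - \<xi> z} \<le> c" .
    qed auto
    then show ?thesis by (simp add: emeasure_density)
  qed
  define c where "c j = ennreal (2 powr real_of_int j)" for j :: int
  have c_double: "c (j + 1) = 2 * c j" for j
    by (simp add: c_def powr_add ennreal_mult' mult.commute)
  have c_mono: "c i \<le> c j" if "i \<le> j" for i j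
    using that by (simp add: c_def ennreal_leI)
  define E where "E j = {y \<in> space N. c j < G (\<eta> y) \<and> G (\<eta> y) \<le> c (j + 1)}" for j
  define D where "D j = {x \<in> space M. c j < G (\<xi> x) \<and> G (\<xi> x) \<le> c (j + 1)}" for j
  have [measurable]: "E j \<in> sets N" "D j \<in> sets M" for j unfolding E_def D_def by measurable
  define A where "A j = (\<integral>\<^sup>+x\<in>D (j - 1) \<union> D j. g x epowr p \<partial>M)" for j
  have level: "c (j - 1) epowr q * emeasure N (E j) \<le> B * A j epowr (q / p)" for j
  proof -
    \<comment> \<open>Every \<open>y\<close> in \<open>E j\<close> yields the bound on the part of \<open>E j\<close> above it only; exhaustion by
        these parts then gives the bound on \<open>E j\<close>.\<close>
    have "emeasure (density N (\<lambda>_. c (j - 1) epowr q)) (E j) \<le> B * A j epowr (q / p)"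
    proof (rule emeasure_le_if_upper_parts_le[where \<eta> = \<eta>])
      fix y assume y: "y \<in> E j"
      let ?t = "\<eta> y"
      have y': "y \<in> space N" "c j < G ?t" "G ?t \<le> c (j + 1)" using y by (auto simp: E_def)
      let ?J = "\<integral>\<^sup>+x\<in>{x. \<xi> x \<le> ?t}. g x * k x * indicator (D (j - 1) \<union> D j) x \<partial>M"
      have "G ?t \<le> (\<integral>\<^sup>+x. g x * k x * indicator {x \<in> space M. G (\<xi> x) \<le> c (j - 1)} x
          + g x * k x * indicator (D (j - 1) \<union> D j) x * indicator {x. \<xi> x \<le> ?t} x \<partial>M)"
        unfolding G_def[of ?t]
      proof (intro nn_integral_mono)
        fix x assume x: "x \<in> space M"
        have "x \<in> {x \<in> space M. G (\<xi> x) \<le> c (j - 1)} \<or> x \<in> D (j - 1) \<union> D j" if "\<xi> x \<le> ?t"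
          using monoD[OF mono_G that] y'(3) x by (auto simp: D_def)
        then show "g x * k x * indicator {x. \<xi> x \<le> ?t} x
            \<le> g x * k x * indicator {x \<in> space M. G (\<xi> x) \<le> c (j - 1)} x
             + g x * k x * indicator (D (j - 1) \<union> D j) x * indicator {x. \<xi> x \<le> ?t} x"
          by (cases "\<xi> x \<le> ?t") (auto simp: indicator_def)
      qed
      also have "\<dots> = (\<integral>\<^sup>+x. g x * k x * indicator {x \<in> space M. G (\<xi> x) \<le> c (j - 1)} x \<partial>M) + ?J"
        by (rule nn_integral_add) auto
      also have "\<dots> \<le> c (j - 1) + ?J" by (intro add_right_mono low_part)
      finally have "c j < c (j - 1) + ?J" using y'(2) by simp
      then have "c (j - 1) \<le> ?J"
        using c_double[of "j - 1"] by (simp add: mult_2 c_def)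
      also have "?J \<le> A j epowr (1/p) * S ?t epowr (1/p')"
        unfolding A_def by (rule Hoelder_on) simp
      finally have "c (j - 1) epowr q \<le> (A j epowr (1/p) * S ?t epowr (1/p')) epowr q"
        using pos by (intro epowr_mono) auto
      also have "\<dots> = A j epowr (q / p) * S ?t epowr (q / p')"
        using pos by (simp add: epowr_mult epowr_epowr)
      finally have *: "c (j - 1) epowr q \<le> A j epowr (q / p) * S ?t epowr (q / p')" .
      have "emeasure (density N (\<lambda>_. c (j - 1) epowr q)) {z \<in> E j. ?t \<le> \<eta> z}
          = c (j - 1) epowr q * emeasure N {z \<in> E j. ?t \<le> \<eta> z}"
        by (rule emeasure_density_const) auto
      also have "\<dots> \<le> c (j - 1) epowr q * U ?t"
        unfolding U_def by (intro mult_left_mono emeasure_mono) (auto simp: E_def)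
      also have "c (j - 1) epowr q * U ?t \<le> A j epowr (q / p) * S ?t epowr (q / p') * U ?t"
        using * by (rule mult_right_mono) simp
      also have "\<dots> \<le> A j epowr (q / p) * B"
        using condition[OF y'(1)] by (simp add: mult.assoc mult_left_mono)
      finally show "emeasure (density N (\<lambda>_. c (j - 1) epowr q)) {z \<in> E j. ?t \<le> \<eta> z}
          \<le> B * A j epowr (q / p)"
        by (simp add: mult.commute)
    qed auto
    then show ?thesis by (simp add: emeasure_density_const)
  qed
  \<comment> \<open>Where \<open>G\<close> is infinite, Hoelder's inequality makes \<open>S\<close> infinite, as \<open>g epowr p\<close> has
      finite integral, and then the hypothesis leaves no room for mass of \<open>N\<close>.\<close>
  have infinite_null: "AE y in N. G (\<eta> y) \<noteq> \<infinity>"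
  proof -
    let ?E = "{y \<in> space N. G (\<eta> y) = \<infinity>}"
    have "emeasure N ?E \<le> 0"
    proof (rule emeasure_le_if_upper_parts_le[where \<eta> = \<eta>])
      fix y assume "y \<in> ?E"
      then have y: "y \<in> space N" "G (\<eta> y) = \<infinity>" by auto
      have "G (\<eta> y) \<le> ?I epowr (1/p) * S (\<eta> y) epowr (1/p')"
      proof -
        have "G (\<eta> y) = (\<integral>\<^sup>+x\<in>{x. \<xi> x \<le> \<eta> y}. g x * k x * indicator (space M) x \<partial>M)"
          unfolding G_def by (intro nn_integral_cong) auto
        also have "\<dots> \<le> (\<integral>\<^sup>+x\<in>space M. g x epowr p \<partial>M) epowr (1/p) * S (\<eta> y) epowr (1/p')"
          by (rule Hoelder_on) simp
        also have "(\<integral>\<^sup>+x\<in>space M. g x epowr p \<partial>M) = ?I" by (intro nn_integral_cong) auto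
        finally show ?thesis .
      qed
      with y have "S (\<eta> y) epowr (1/p') = \<infinity>"
        using I_fin pos by (auto simp: top_unique ennreal_mult_eq_top_iff epowr_eq_top_iff[simplified])
      then have "S (\<eta> y) = \<infinity>" using pos by (simp add: epowr_eq_top_iff[simplified])
      then have "U (\<eta> y) = 0"
        using condition[OF y(1)] B pos by (cases "U (\<eta> y) = 0") (auto simp: ennreal_top_mult top_unique)
      moreover have "emeasure N {z \<in> ?E. \<eta> y \<le> \<eta> z} \<le> U (\<eta> y)"
        unfolding U_def by (rule emeasure_mono) auto
      ultimately show "emeasure N {z \<in> ?E. \<eta> y \<le> \<eta> z} \<le> 0" by simp
    qed auto
    then have "?E \<in> null_sets N" by (auto simp: null_sets_def)
    then show ?thesis by (rule AE_I') auto
  qed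
  \<comment> \<open>The levels are indexed by integers; \<open>int_decode\<close> enumerates them, so that
      countable sums are series.\<close>
  have "?L \<le> (\<integral>\<^sup>+y. (\<Sum>n. c (int_decode n + 1) epowr q * indicator (E (int_decode n)) y) \<partial>N)"
  proof (rule nn_integral_mono_AE)
    from infinite_null AE_space show "AE y in N. (\<integral>\<^sup>+x\<in>{x. \<xi> x \<le> \<eta> y}. g x * k x \<partial>M) epowr q
        \<le> (\<Sum>n. c (int_decode n + 1) epowr q * indicator (E (int_decode n)) y)"
    proof eventually_elim
      case (elim y)
      show ?case
      proof (cases "G (\<eta> y) = 0")
        case True
        then show ?thesis using pos by (simp add: G_def)
      next
        case False
        then obtain j where "c j < G (\<eta> y)" "G (\<eta> y) \<le> c (j + 1)"
          using ennreal_dyadic_cover[of "G (\<eta> y)"] elim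
          by (auto simp: c_def zero_less_iff_neq_zero less_top)
        then have "y \<in> E j" and "G (\<eta> y) epowr q \<le> c (j + 1) epowr q"
          using elim pos by (auto simp: E_def intro: epowr_mono)
        then have "G (\<eta> y) epowr q \<le> c (int_decode (int_encode j) + 1) epowr q
            * indicator (E (int_decode (int_encode j))) y" by simp
        also have "\<dots> \<le> (\<Sum>n. c (int_decode n + 1) epowr q * indicator (E (int_decode n)) y)"
          using sum_le_suminf[OF summableI, of "{int_encode j}"
              "\<lambda>n. c (int_decode n + 1) epowr q * indicator (E (int_decode n)) y :: ennreal"] by simp
        finally show ?thesis by (simp add: G_def)
      qed
    qed
  qed
  also have "\<dots> = (\<Sum>n. c (int_decode n + 1) epowr q * emeasure N (E (int_decode n)))"
    by (subst nn_integral_suminf) (auto simp: nn_integral_cmult_indicator)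
  also have "\<dots> \<le> (\<Sum>n. 4 epowr q * B * A (int_decode n) epowr (q / p))"
  proof (intro suminf_le summableI)
    fix n
    let ?j = "int_decode n"
    have "c (?j + 1) = 4 * c (?j - 1)"
      using c_double[of ?j] c_double[of "?j - 1"] by (simp flip: mult.assoc)
    then have "c (?j + 1) epowr q * emeasure N (E ?j) = 4 epowr q * (c (?j - 1) epowr q * emeasure N (E ?j))"
      using pos by (simp add: epowr_mult mult.assoc)
    also have "\<dots> \<le> 4 epowr q * (B * A ?j epowr (q / p))"
      by (intro mult_left_mono level) simp
    finally show "c (?j + 1) epowr q * emeasure N (E ?j) \<le> 4 epowr q * B * A ?j epowr (q / p)"
      by (simp add: mult.assoc)
  qed
  also have "\<dots> = 4 epowr q * B * (\<Sum>n. A (int_decode n) epowr (q / p))" by simp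
  also have "\<dots> \<le> 4 epowr q * B * (\<Sum>n. A (int_decode n)) epowr (q / p)"
    using q pos by (intro mult_left_mono suminf_epowr_le) auto
  also have "(\<Sum>n. A (int_decode n)) \<le> 2 * ?I"
  proof -
    have disj: "disjoint_family (\<lambda>n. D (int_decode n - d))" for d
    proof -
      have "D i \<inter> D j = {}" if "i < j" for i j
        using c_mono[of "i + 1" j] that by (auto simp: D_def)
      then have "D i \<inter> D j = {}" if "i \<noteq> j" for i j
        using that by (metis Int_commute linorder_less_linear)
      moreover have "int_decode m - d \<noteq> int_decode n - d" if "m \<noteq> n" for m n
        using that by (simp add: int_decode_eq)
      ultimately show ?thesis unfolding disjoint_family_on_def by blast
    qed
    have ind: "(\<Sum>n. indicator (D (int_decode n - d)) x :: ennreal) \<le> 1" for d x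
      by (subst suminf_indicator[OF disj]) (simp add: indicator_def)
    have "(\<Sum>n. A (int_decode n))
        = (\<integral>\<^sup>+x. (\<Sum>n. g x epowr p * indicator (D (int_decode n - 1) \<union> D (int_decode n)) x) \<partial>M)"
      unfolding A_def by (subst nn_integral_suminf) auto
    also have "\<dots> \<le> (\<integral>\<^sup>+x. 2 * g x epowr p \<partial>M)"
    proof (rule nn_integral_mono)
      fix x
      have "(\<Sum>n. indicator (D (int_decode n - 1) \<union> D (int_decode n)) x :: ennreal)
          \<le> (\<Sum>n. indicator (D (int_decode n - 1)) x + indicator (D (int_decode n - 0)) x)"
        by (intro suminf_le summableI) (auto simp: indicator_def)
      also have "\<dots> = (\<Sum>n. indicator (D (int_decode n - 1)) x) + (\<Sum>n. indicator (D (int_decode n - 0)) x)"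
        by (rule suminf_add[symmetric]) (rule summableI)+
      also have "\<dots> \<le> 1 + 1" by (intro add_mono ind)
      finally show "(\<Sum>n. g x epowr p * indicator (D (int_decode n - 1) \<union> D (int_decode n)) x)
          \<le> 2 * g x epowr p"
        by (simp add: mult.commute[of _ "g x epowr p"] mult_left_mono one_add_one)
    qed
    also have "\<dots> = 2 * ?I" by (rule nn_integral_cmult) simp
    finally show ?thesis .
  qed
  then have "4 epowr q * B * (\<Sum>n. A (int_decode n)) epowr (q / p)
      \<le> 4 epowr q * B * (2 * ?I) epowr (q / p)"
    using pos by (intro mult_left_mono epowr_mono) auto
  finally show ?thesis
    using pos by (simp add: epowr_mult ac_simps)
qed

section \<open>Lebesgue measure on the half-line\<close>

lemma half_line_in_sets_lebesgue [measurable, simp]: "{0<..} \<in> sets (lebesgue :: real measure)"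
  by (rule sets_completionI_sets) simp

lemma nn_integral_over_half_line:
  fixes h :: "real \<Rightarrow> ennreal"
  assumes "A \<subseteq> {0<..}"
  shows "(\<integral>\<^sup>+x\<in>A. h x \<partial>lebesgue) = (\<integral>\<^sup>+x\<in>A. h x \<partial>lebesgue_on {0<..})"
  using assms by (subst nn_integral_restrict_space) (auto intro!: nn_integral_cong split: split_indicator)

lemma wnorm_half_line:
  "wnorm r g h = (\<integral>\<^sup>+x. ennreal (g x) * ennreal (cmod (h x)) epowr r \<partial>lebesgue_on {0<..}) epowr (1/r)"
  unfolding wnorm_def nn_integral_over_half_line[OF subset_refl]
  by (intro arg_cong[where f = "\<lambda>z. z epowr (1/r)"] nn_integral_cong) auto

lemma nn_loc_integrable_half_line:
  assumes "nn_loc_integrable h" "0 < b"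
  shows "(\<integral>\<^sup>+x\<in>{0<..b}. h x \<partial>lebesgue_on {0<..}) < \<infinity>"
  using assms by (subst nn_integral_over_half_line[symmetric]) (auto simp: nn_loc_integrable_def)

lemma AE_half_line_neq: "AE x in lebesgue_on {0<..}. x \<noteq> (r::real)"
proof -
  have "AE x in lebesgue. x \<noteq> r" by (rule AE_completion) (rule AE_lborel_singleton)
  then show ?thesis by (subst AE_restrict_space_iff) auto
qed

lemma borel_measurable_half_line_mono:
  assumes "mono_on {0<..} (s :: real \<Rightarrow> real)"
  shows "s \<in> borel_measurable (lebesgue_on {0<..})"
proof -
  have "(\<lambda>x. indicator {0<..} x *\<^sub>R s x) \<in> borel_measurable lborel"
    using borel_measurable_mono_on_fnc[OF assms] borel_measurable_restrict_space_iff[of "{0<..}" borel s]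
    by simp
  then have "(\<lambda>x. indicator {0<..} x *\<^sub>R s x) \<in> borel_measurable lebesgue"
    by (rule measurable_completion)
  then show ?thesis by (subst borel_measurable_restrict_space_iff) auto
qed

section \<open>The Hardy inequality for power weights\<close>

lemma conjugate_exponent:
  assumes "1 < p" "1 / p + 1 / p' = (1::real)"
  shows "1 < p'" "p + p' = p * p'" "p' / p = p' - 1"
proof -
  have "1/p < 1" "0 < 1/p" using assms(1) by auto
  then have *: "0 < 1/p'" "1/p' < 1" using assms by linarith+
  then show "1 < p'" by (simp add: divide_less_eq split: if_splits)
  then show "p + p' = p * p'" "p' / p = p' - 1"
    using assms by (auto simp: field_simps)
qed

text \<open>The weighted Hardy inequality for \<open>g = v^(1/p) s^\<alpha> F\<close>, \<open>k = v^(-1/p) s^\<beta>\<close> and the measure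
  with density \<open>u w^(q \<beta>)\<close>. Then \<open>g k = s^(\<alpha>+\<beta>) F\<close> wherever \<open>v > 0\<close>, and
  \<open>k^p' = v^(1-p') s^(p' \<beta>)\<close>. Both halves of the characterisation use it, with
  \<open>\<beta> = 1/a'\<close> and with \<open>\<beta> = 1/a' - 1/2\<close>.\<close>
lemma Hardy_for_power_weights:
  fixes s w u v F \<xi> \<eta> :: "real \<Rightarrow> real"
  defines "L \<equiv> lebesgue_on {0<..}"
  assumes p: "1 < p" "1 / p + 1 / p' = 1" and q: "p \<le> q"
    and s_pos: "\<And>x. x > 0 \<Longrightarrow> 0 < s x" and w_pos: "\<And>y. y > 0 \<Longrightarrow> 0 < w y"
    and v_nonneg: "\<And>x. x > 0 \<Longrightarrow> 0 \<le> v x" and v_pos: "AE x in L. 0 < v x"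
    and F_nonneg: "\<And>x. 0 \<le> F x"
    and [measurable]: "s \<in> borel_measurable L" "w \<in> borel_measurable L" "u \<in> borel_measurable L"
      "v \<in> borel_measurable L" "F \<in> borel_measurable L"
      "\<xi> \<in> borel_measurable L" "\<eta> \<in> borel_measurable L"
    and B: "0 < B" "B < \<infinity>"
    and cond: "\<And>y. y > 0 \<Longrightarrow>
      (\<integral>\<^sup>+z\<in>{z. \<eta> y \<le> \<eta> z}. ennreal (u z) * ennreal (w z) epowr (q * \<beta>) \<partial>L) epowr (1 / q)
      * (\<integral>\<^sup>+x\<in>{x. \<xi> x \<le> \<eta> y}. ennreal (v x) epowr (1 - p') * ennreal (s x) epowr (p' * \<beta>) \<partial>L) epowr (1 / p')
      \<le> B"
  shows "(\<integral>\<^sup>+y. ennreal (u y) * (ennreal (w y powr \<beta>)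
            * (\<integral>\<^sup>+x\<in>{x. \<xi> x \<le> \<eta> y}. ennreal (s x powr (\<alpha> + \<beta>) * F x) \<partial>L)) epowr q \<partial>L)
    \<le> 4 epowr q * 2 epowr (q / p) * B epowr q
      * (\<integral>\<^sup>+x. ennreal (v x) * ennreal (s x powr \<alpha> * F x) epowr p \<partial>L) epowr (q / p)"
proof -
  have p': "1 < p'" "p + p' = p * p'" "p' / p = p' - 1" using conjugate_exponent[OF p] by auto
  have pos: "0 < p" "0 < q" "0 < p'" using p q p' by auto
  have space_L: "space L = {0<..}" by (simp add: L_def)
  define \<nu> where "\<nu> y = ennreal (u y) * ennreal (w y) epowr (q * \<beta>)" for y
  define N where "N = density L \<nu>"
  define g where "g x = ennreal (v x powr (1/p) * (s x powr \<alpha> * F x))" for x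
  define k where "k x = ennreal (v x powr (- 1/p) * s x powr \<beta>)" for x
  have [measurable]: "\<nu> \<in> borel_measurable L" "g \<in> borel_measurable L" "k \<in> borel_measurable L"
    unfolding \<nu>_def g_def k_def by measurable
  have sets_N [measurable_cong]: "sets N = sets L" by (simp add: N_def)
  have space_N: "space N = {0<..}" by (simp add: N_def space_L)
  have gk: "AE x in L. g x * k x = ennreal (s x powr (\<alpha> + \<beta>) * F x)"
    using v_pos
  proof eventually_elim
    case (elim x)
    have "v x powr (1/p) * v x powr (- 1/p) = 1" using elim by (simp flip: powr_add)
    then have "(v x powr (1/p) * (s x powr \<alpha> * F x)) * (v x powr (- 1/p) * s x powr \<beta>)
       = s x powr (\<alpha> + \<beta>) * F x"
      by (simp add: powr_add algebra_simps)
    then show ?case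
      using F_nonneg by (simp add: g_def k_def flip: ennreal_mult)
  qed
  have kp: "AE x in L. k x epowr p' = ennreal (v x) epowr (1 - p') * ennreal (s x) epowr (p' * \<beta>)"
    using v_pos AE_space
  proof eventually_elim
    case (elim x)
    then have "s x > 0" using s_pos by (simp add: space_L)
    moreover have "- p' / p = 1 - p'" using p'(3) by simp
    moreover have "k x epowr p' = ennreal ((v x powr (- 1/p) * s x powr \<beta>) powr p')"
      unfolding k_def using pos by (intro epowr_ennreal_pos_exponent) auto
    ultimately show ?case
      using elim by (simp add: epowr_ennreal powr_mult powr_powr ennreal_mult mult.commute[of \<beta>])
  qed
  have gp: "(\<integral>\<^sup>+x. g x epowr p \<partial>L) = (\<integral>\<^sup>+x. ennreal (v x) * ennreal (s x powr \<alpha> * F x) epowr p \<partial>L)"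
  proof (rule nn_integral_cong)
    fix x assume "x \<in> space L"
    then have "v x \<ge> 0" using v_nonneg by (simp add: space_L)
    then show "g x epowr p = ennreal (v x) * ennreal (s x powr \<alpha> * F x) epowr p"
      using pos F_nonneg[of x]
      by (simp add: g_def epowr_ennreal_pos_exponent powr_powr ennreal_mult epowr_mult)
  qed
  have "(\<integral>\<^sup>+y. (\<integral>\<^sup>+x\<in>{x. \<xi> x \<le> \<eta> y}. g x * k x \<partial>L) epowr q \<partial>N)
    \<le> 4 epowr q * 2 epowr (q / p) * B epowr q * (\<integral>\<^sup>+x. g x epowr p \<partial>L) epowr (q / p)"
  proof (rule weighted_Hardy_inequality[OF p q])
    show "0 < B epowr q" "B epowr q < \<infinity>"
      using B pos epowr_eq_0_iff[of q B] epowr_eq_top_iff[of q B]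
      by (auto simp: zero_less_iff_neq_zero less_top)
    fix y assume "y \<in> space N"
    then have y: "y > 0" by (simp add: space_N)
    have 1: "(\<integral>\<^sup>+x\<in>{x. \<xi> x \<le> \<eta> y}. k x epowr p' \<partial>L)
        = (\<integral>\<^sup>+x\<in>{x. \<xi> x \<le> \<eta> y}. ennreal (v x) epowr (1 - p') * ennreal (s x) epowr (p' * \<beta>) \<partial>L)"
      using kp by (intro nn_integral_cong_AE) auto
    have 2: "emeasure N {z \<in> space N. \<eta> y \<le> \<eta> z} = (\<integral>\<^sup>+z\<in>{z. \<eta> y \<le> \<eta> z}. \<nu> z \<partial>L)"
      unfolding N_def by (subst emeasure_density) (auto intro!: nn_integral_cong split: split_indicator)
    from cond[OF y] have "((\<integral>\<^sup>+z\<in>{z. \<eta> y \<le> \<eta> z}. \<nu> z \<partial>L) epowr (1 / q)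
      * (\<integral>\<^sup>+x\<in>{x. \<xi> x \<le> \<eta> y}. k x epowr p' \<partial>L) epowr (1 / p')) epowr q \<le> B epowr q"
      unfolding 1 \<nu>_def using pos by (intro epowr_mono) auto
    then show "(\<integral>\<^sup>+x\<in>{x. \<xi> x \<le> \<eta> y}. k x epowr p' \<partial>L) epowr (q / p')
       * emeasure N {z \<in> space N. \<eta> y \<le> \<eta> z} \<le> B epowr q"
      unfolding 2 using pos by (simp add: epowr_mult epowr_epowr mult.commute)
  qed auto
  also have "(\<integral>\<^sup>+y. (\<integral>\<^sup>+x\<in>{x. \<xi> x \<le> \<eta> y}. g x * k x \<partial>L) epowr q \<partial>N)
      = (\<integral>\<^sup>+y. (\<integral>\<^sup>+x\<in>{x. \<xi> x \<le> \<eta> y}. ennreal (s x powr (\<alpha> + \<beta>) * F x) \<partial>L) epowr q \<partial>N)"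
    using gk by (intro nn_integral_cong arg_cong[where f = "\<lambda>z. z epowr q"] nn_integral_cong_AE) auto
  also have "\<dots> = (\<integral>\<^sup>+y. \<nu> y * (\<integral>\<^sup>+x\<in>{x. \<xi> x \<le> \<eta> y}. ennreal (s x powr (\<alpha> + \<beta>) * F x) \<partial>L) epowr q \<partial>L)"
  proof -
    note [measurable] = borel_measurable_integral_up_to[of \<eta> L]
    have "(\<lambda>y. (\<integral>\<^sup>+x\<in>{x. \<xi> x \<le> \<eta> y}. ennreal (s x powr (\<alpha> + \<beta>) * F x) \<partial>L) epowr q) \<in> borel_measurable L"
      by measurable
    then show ?thesis unfolding N_def by (subst nn_integral_density) auto
  qed
  also have "\<dots> = (\<integral>\<^sup>+y. ennreal (u y) * (ennreal (w y powr \<beta>)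
            * (\<integral>\<^sup>+x\<in>{x. \<xi> x \<le> \<eta> y}. ennreal (s x powr (\<alpha> + \<beta>) * F x) \<partial>L)) epowr q \<partial>L)"
    using w_pos pos
    by (intro nn_integral_cong)
       (simp add: \<nu>_def space_L epowr_mult epowr_ennreal epowr_ennreal_pos_exponent powr_powr
          mult.assoc mult.commute[of q \<beta>])
  finally show ?thesis unfolding gp .
qed

section \<open>The two regimes of the kernel\<close>

text \<open>Monotonicity of \<open>w\<close> compares \<open>s x * w y\<close> with \<open>s x * w (1 / x)\<close>, which is comparable to \<open>1\<close>. So the
  first term of the minimum governs \<open>K\<close> up to constants when \<open>x * y \<le> 1\<close>, and the second when
  \<open>x * y \<ge> 1\<close>. The upper bounds hold everywhere because a minimum is below both of its terms.\<close>
lemma kernel_two_regimes: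
  fixes s w :: "real \<Rightarrow> real" and K :: "real \<Rightarrow> real \<Rightarrow> real"
  assumes s_pos: "\<And>x. x > 0 \<Longrightarrow> 0 < s x" and w_pos: "\<And>y. y > 0 \<Longrightarrow> 0 < w y"
    and w_mono: "mono_on {0<..} w"
    and s_w: "comparable_on {0<..} (\<lambda>x. s x * w (1 / x)) (\<lambda>_. 1)"
    and K_est: "comparable_on ({0<..} \<times> {0<..}) (\<lambda>(x, y). K x y)
                  (\<lambda>(x, y). min 1 ((s x * w y) powr (- 1 / 2)))"
  obtains c C where "0 < c" "0 < C"
    "\<And>x y. x > 0 \<Longrightarrow> y > 0 \<Longrightarrow> x * y \<le> 1 \<Longrightarrow> c \<le> K x y"
    "\<And>x y. x > 0 \<Longrightarrow> y > 0 \<Longrightarrow> 1 \<le> x * y \<Longrightarrow> c * (s x * w y) powr (- 1 / 2) \<le> K x y"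
    "\<And>x y. x > 0 \<Longrightarrow> y > 0 \<Longrightarrow> 0 \<le> K x y"
    "\<And>x y. x > 0 \<Longrightarrow> y > 0 \<Longrightarrow> K x y \<le> C"
    "\<And>x y. x > 0 \<Longrightarrow> y > 0 \<Longrightarrow> K x y \<le> C * (s x * w y) powr (- 1 / 2)"
proof -
  obtain m L where mL: "m > 0" "L > 0"
      "\<And>x. x > 0 \<Longrightarrow> m \<le> s x * w (1/x)" "\<And>x. x > 0 \<Longrightarrow> s x * w (1/x) \<le> L"
    using s_w by (auto simp: comparable_on_def)
  obtain k0 C where K: "k0 > 0" "C > 0"
      "\<And>x y. x > 0 \<Longrightarrow> y > 0 \<Longrightarrow> k0 * min 1 ((s x * w y) powr (- 1 / 2)) \<le> K x y"
      "\<And>x y. x > 0 \<Longrightarrow> y > 0 \<Longrightarrow> K x y \<le> C * min 1 ((s x * w y) powr (- 1 / 2))"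
    using K_est by (auto simp: comparable_on_def)
  \<comment> \<open>With \<open>z = (s x * w y) powr (- 1/2)\<close>, the factor \<open>L powr (- 1/2)\<close> is a lower bound for \<open>z\<close>
      when \<open>x * y \<le> 1\<close>, and \<open>m powr (1/2) * z\<close> is at most \<open>1\<close> when \<open>x * y \<ge> 1\<close>.\<close>
  define c where "c = k0 * min (min 1 (L powr (- 1 / 2))) (m powr (1 / 2))"
  show ?thesis
  proof (rule that[of c C])
    show "0 < c" using K mL by (simp add: c_def)
    show "0 < C" by fact
    fix x y :: real assume xy: "x > 0" "y > 0"
    have sw: "0 < s x * w y" using s_pos w_pos xy by simp
    show "0 \<le> K x y" using K(1) K(3)[OF xy] by (smt (verit) mult_nonneg_nonneg powr_ge_zero)
    show "K x y \<le> C" using K(2) K(4)[OF xy]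
      by (smt (verit, best) min.cobounded1 mult_left_le)
    show "K x y \<le> C * (s x * w y) powr (- 1 / 2)"
      using K(2) K(4)[OF xy] by (smt (verit, best) min.cobounded2 mult_left_mono)
    {
      assume "x * y \<le> 1"
      then have "w y \<le> w (1/x)"
        using xy by (intro mono_onD[OF w_mono]) (auto simp: field_simps)
      then have "s x * w y \<le> L"
        using mL(4)[of x] s_pos[of x] xy by (smt (verit) mult_left_mono)
      then have "L powr (- 1/2) \<le> (s x * w y) powr (- 1/2)"
        using sw by (intro powr_mono2') auto
      then have "min (min 1 (L powr (- 1 / 2))) (m powr (1 / 2)) \<le> min 1 ((s x * w y) powr (- 1 / 2))"
        by linarith
      then show "c \<le> K x y"
        using K(1) K(3)[OF xy] unfolding c_def by (smt (verit) mult_left_mono)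
    }
    {
      assume "1 \<le> x * y"
      then have "w (1/x) \<le> w y"
        using xy by (intro mono_onD[OF w_mono]) (auto simp: field_simps)
      then have "m \<le> s x * w y"
        using mL(3)[of x] s_pos[of x] xy by (smt (verit) mult_left_mono)
      then have "(s x * w y) powr (- 1/2) \<le> m powr (- 1/2)"
        using mL by (intro powr_mono2') auto
      then have "m powr (1/2) * (s x * w y) powr (- 1/2) \<le> m powr (1/2) * m powr (- 1/2)"
        by (intro mult_left_mono) auto
      also have "\<dots> = 1" using mL by (simp flip: powr_add)
      finally have *: "m powr (1/2) * (s x * w y) powr (- 1/2) \<le> 1" .
      define z where "z = (s x * w y) powr (- 1/2)"
      define a where "a = min (min 1 (L powr (- 1 / 2))) (m powr (1 / 2))"
      have "z \<ge> 0" "a \<le> 1" "a \<le> m powr (1/2)" by (auto simp: z_def a_def)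
      then have "a * z \<le> min 1 z"
        using * mult_right_mono[of a 1 z] mult_right_mono[of a "m powr (1/2)" z]
        by (auto simp: z_def)
      then have "k0 * (a * z) \<le> K x y"
        using K(1) K(3)[OF xy] unfolding z_def by (smt (verit) mult_left_mono)
      then show "c * (s x * w y) powr (- 1 / 2) \<le> K x y"
        by (simp add: c_def a_def z_def mult.assoc)
    }
  qed
qed

section \<open>Necessity by test functions\<close>

text \<open>Monotone convergence in the form needed for the test functions, which live on subintervals
  bounded away from \<open>0\<close> and \<open>\<infinity>\<close>: multiplied through by the factor, and with the root
  removed, the bounds on parts of \<open>E\<close> are bounds on the measure with density
  \<open>X epowr (1 / t) * h\<close>.\<close>
lemma mult_epowr_nn_integral_le_if_upper_parts_le:
  fixes \<eta> :: "'b \<Rightarrow> real"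
  assumes [measurable]: "\<eta> \<in> borel_measurable N" "E \<in> sets N" "h \<in> borel_measurable N" and t: "t > 0"
    and le: "\<And>y. y \<in> E \<Longrightarrow> X * (\<integral>\<^sup>+x\<in>{z \<in> E. \<eta> y \<le> \<eta> z}. h x \<partial>N) epowr t \<le> Y"
  shows "X * (\<integral>\<^sup>+x\<in>E. h x \<partial>N) epowr t \<le> Y"
proof -
  have root: "X * Z epowr t \<le> Y \<longleftrightarrow> X epowr (1/t) * Z \<le> Y epowr (1/t)" for Z
  proof -
    have "X epowr (1/t) * Z = (X * Z epowr t) epowr (1/t)"
      using t by (simp add: epowr_mult epowr_epowr)
    then show ?thesis using t by (simp add: epowr_le_iff)
  qed
  have ind: "emeasure (density N (\<lambda>x. X epowr (1/t) * h x)) A = X epowr (1/t) * (\<integral>\<^sup>+x\<in>A. h x \<partial>N)"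
    if [measurable]: "A \<in> sets N" for A
    by (simp add: emeasure_density mult.assoc nn_integral_cmult)
  have "emeasure (density N (\<lambda>x. X epowr (1/t) * h x)) E \<le> Y epowr (1/t)"
  proof (rule emeasure_le_if_upper_parts_le[where \<eta> = \<eta>])
    fix y assume y: "y \<in> E"
    have "{z \<in> E. \<eta> y \<le> \<eta> z} = E \<inter> {z \<in> space N. \<eta> y \<le> \<eta> z}"
      using sets.sets_into_space[of E N] by auto
    then have "{z \<in> E. \<eta> y \<le> \<eta> z} \<in> sets N" by simp
    then show "emeasure (density N (\<lambda>x. X epowr (1/t) * h x)) {z \<in> E. \<eta> y \<le> \<eta> z} \<le> Y epowr (1/t)"
      using le[OF y] root ind by simp
  qed auto
  then show ?thesis using root ind by simp
qed

lemma powr_le_powr_endpoints: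
  assumes "0 < a" "a \<le> z" "z \<le> (b::real)"
  shows "z powr t \<le> a powr t + b powr t"
proof (cases "t \<ge> 0")
  case True
  then have "z powr t \<le> b powr t" using assms by (intro powr_mono2) auto
  then show ?thesis by (simp add: add_increasing)
next
  case False
  then have "z powr t \<le> a powr t" using assms by (intro powr_mono2') auto
  then show ?thesis by (simp add: add_increasing2)
qed

text \<open>Necessity, localised. Where the kernel is at least \<open>c (s x * w y)^(-\<delta>)\<close>, the inequality is
  tested on \<open>f = v^(1-p') s^(p' \<beta> + \<delta> - 1)\<close> cut off to \<open>J\<close>. This exponent is the one for which
  equality holds in Hoelder's inequality: \<open>s^(1-\<delta>) f\<close> and \<open>v (s^\<alpha> f)^p\<close> are both
  \<open>v^(1-p') s^(p' \<beta>)\<close> on \<open>J\<close>. Writing \<open>\<Sigma>\<close> for the integral of this function over \<open>J\<close>, the left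
  side is at least \<open>c \<Sigma>\<close> times the \<open>L^q\<close> norm of \<open>w^\<beta>\<close> over \<open>E\<close> with weight \<open>u\<close>, the right side is
  \<open>C \<Sigma>^(1/p)\<close>, and \<open>\<Sigma>^(1/p)\<close> cancels because it is finite; if it vanishes the claim is trivial. The set \<open>J\<close> stays away from \<open>0\<close> and
  \<open>\<infinity>\<close> so that all powers of \<open>s\<close> are bounded on it; this makes \<open>f\<close> admissible. Without the cut-off, \<open>f\<close>
  may fail to be integrable near the origin if \<open>s\<close> tends to \<open>0\<close> there.\<close>
lemma test_function_bound:
  fixes s w u v :: "real \<Rightarrow> real" and K :: "real \<Rightarrow> real \<Rightarrow> real"
  defines "L \<equiv> lebesgue_on {0<..}"
  assumes p: "1 < p" "1 / p + 1 / p' = 1" and q: "0 < q"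
    and \<alpha>: "\<alpha> + \<beta>0 = 1" and \<beta>: "\<beta> = \<beta>0 - \<delta>"
    and s_pos: "\<And>x. x > 0 \<Longrightarrow> 0 < s x" and w_pos: "\<And>y. y > 0 \<Longrightarrow> 0 < w y"
    and s_mono: "mono_on {0<..} s" and w_mono: "mono_on {0<..} w"
    and v_nonneg: "\<And>x. x > 0 \<Longrightarrow> 0 \<le> v x" and v_pos: "AE x in L. 0 < v x"
    and [measurable]: "u \<in> borel_measurable L" "v \<in> borel_measurable L"
    and v_loc: "nn_loc_integrable
                  (\<lambda>x. ennreal (v x) epowr (1 - p') * ennreal (s x) epowr (p' * \<beta>0))"
    and K_meas: "\<And>y. y > 0 \<Longrightarrow> (\<lambda>x. K x y) \<in> borel_measurable L"
    and K_nonneg: "\<And>x y. x > 0 \<Longrightarrow> y > 0 \<Longrightarrow> 0 \<le> K x y"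
    and K_le: "\<And>x y. x > 0 \<Longrightarrow> y > 0 \<Longrightarrow> K x y \<le> Cmax"
    and ineq: "\<And>f. admissible s f \<Longrightarrow>
        wnorm q u (\<lambda>y. of_real (w y powr \<beta>0) * transform s K f y)
          \<le> ennreal C * wnorm p v (\<lambda>x. of_real (s x powr \<alpha>) * f x)"
    and J: "J \<in> sets L" "J \<subseteq> {a..b}" "0 < a" and E: "E \<in> sets L"
    and K_ge: "\<And>x y. x \<in> J \<Longrightarrow> y \<in> E \<Longrightarrow> c * (s x * w y) powr (- \<delta>) \<le> K x y" and c: "0 < c" and C: "0 < C"
  shows "(\<integral>\<^sup>+y\<in>E. ennreal (u y) * ennreal (w y) epowr (q * \<beta>) \<partial>L) epowr (1 / q)
      * (\<integral>\<^sup>+x\<in>J. ennreal (v x) epowr (1 - p') * ennreal (s x) epowr (p' * \<beta>) \<partial>L) epowr (1 / p')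
      \<le> ennreal (C / c)"
proof -
  have p': "1 < p'" "p + p' = p * p'" "p' / p = p' - 1" using conjugate_exponent[OF p] by auto
  have pos: "0 < p" "0 < p'" using p p' by auto
  have space_L: "space L = {0<..}" by (simp add: L_def)
  note [measurable] = borel_measurable_half_line_mono[OF s_mono, folded L_def]
    borel_measurable_half_line_mono[OF w_mono, folded L_def] J(1) E K_meas
  have J_pos: "x > 0" if "x \<in> J" for x using J that by force
  have E_pos: "y > 0" if "y \<in> E" for y using sets.sets_into_space[OF E] that by (auto simp: space_L)
  have J_in: "a \<le> x" "x \<le> b" if "x \<in> J" for x using J(2) that by auto
  define \<sigma> where "\<sigma> x = v x powr (1 - p') * indicator J x" for x
  have \<sigma>_nonneg: "0 \<le> \<sigma> x" for x by (simp add: \<sigma>_def)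
  have [measurable]: "\<sigma> \<in> borel_measurable L" unfolding \<sigma>_def by measurable
  \<comment> \<open>On \<open>J\<close> every power of \<open>s\<close> is at most a constant times \<open>s powr (p' * \<beta>0)\<close>, so
      local integrability for one exponent gives finiteness for all.\<close>
  have moment: "(\<integral>\<^sup>+x. ennreal (\<sigma> x * s x powr t) \<partial>L) < \<infinity>" for t
  proof (cases "J = {}")
    case False
    then have ab: "a \<le> b" using J_in by force
    with J(3) have b: "0 < b" by simp
    let ?D = "s a powr (t - p' * \<beta>0) + s b powr (t - p' * \<beta>0)"
    let ?h = "\<lambda>x. ennreal (v x) epowr (1 - p') * ennreal (s x) epowr (p' * \<beta>0)"
    have "(\<integral>\<^sup>+x. ennreal (\<sigma> x * s x powr t) \<partial>L) \<le> (\<integral>\<^sup>+x. ennreal ?D * (?h x * indicator {0<..b} x) \<partial>L)"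
    proof (rule nn_integral_mono)
      fix x
      show "ennreal (\<sigma> x * s x powr t) \<le> ennreal ?D * (?h x * indicator {0<..b} x)"
      proof (cases "x \<in> J \<and> v x \<noteq> 0")
        case True
        then have x: "x > 0" "a \<le> x" "x \<le> b" "v x > 0" "x \<in> J" using J_pos J_in v_nonneg by (auto simp: order_less_le)
        have "s x powr t = s x powr (p' * \<beta>0) * s x powr (t - p' * \<beta>0)"
          using s_pos[OF x(1)] by (simp flip: powr_add)
        also have "\<dots> \<le> s x powr (p' * \<beta>0) * ?D"
          using x J(3) b s_pos[of a] by (intro mult_left_mono powr_le_powr_endpoints mono_onD[OF s_mono]) auto
        finally have "v x powr (1 - p') * s x powr t \<le> v x powr (1 - p') * (s x powr (p' * \<beta>0) * ?D)"
          by (rule mult_left_mono) simp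
        also have "\<dots> = ?D * (v x powr (1 - p') * s x powr (p' * \<beta>0))"
          by (simp only: ac_simps)
        finally have "v x powr (1 - p') * s x powr t \<le> ?D * (v x powr (1 - p') * s x powr (p' * \<beta>0))" .
        then have "ennreal (\<sigma> x * s x powr t) \<le> ennreal (?D * (v x powr (1 - p') * s x powr (p' * \<beta>0)))"
          using x by (intro ennreal_leI) (simp add: \<sigma>_def)
        also have "\<dots> = ennreal ?D * (?h x * indicator {0<..b} x)"
          using x s_pos[OF x(1)] by (simp add: epowr_ennreal ennreal_mult)
        finally show ?thesis .
      qed (auto simp: \<sigma>_def)
    qed
    also have "\<dots> = ennreal ?D * (\<integral>\<^sup>+x\<in>{0<..b}. ?h x \<partial>L)"
    proof (rule nn_integral_cmult)
      have [measurable]: "{0<..b} \<in> sets L" by (auto simp: L_def sets_restrict_space_iff)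
      show "(\<lambda>x. ?h x * indicator {0<..b} x) \<in> borel_measurable L" by measurable
    qed
    also have "\<dots> < \<infinity>"
      using nn_loc_integrable_half_line[OF v_loc b] unfolding L_def[symmetric]
      by (auto simp: ennreal_mult_less_top)
    finally show ?thesis .
  qed (simp add: \<sigma>_def)
  define f :: "real \<Rightarrow> complex" where "f x = of_real (\<sigma> x * s x powr (p' * \<beta> + \<delta> - 1))" for x
  have [measurable]: "f \<in> borel_measurable L" unfolding f_def by measurable
  have cmod_f: "cmod (f x) = \<sigma> x * s x powr (p' * \<beta> + \<delta> - 1)" for x
    unfolding f_def norm_of_real using \<sigma>_nonneg[of x] by (simp add: abs_mult)
  have s_f: "s x powr r * cmod (f x) = \<sigma> x * s x powr (p' * \<beta> + \<delta> - 1 + r)" if "x > 0" for x r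
    using s_pos[OF that] by (simp add: cmod_f powr_add)
  define \<Sigma> where "\<Sigma> = (\<integral>\<^sup>+x. ennreal (\<sigma> x * s x powr (p' * \<beta>)) \<partial>L)"
  have \<Sigma>_eq: "\<Sigma> = (\<integral>\<^sup>+x\<in>J. ennreal (v x) epowr (1 - p') * ennreal (s x) epowr (p' * \<beta>) \<partial>L)"
    unfolding \<Sigma>_def
  proof (rule nn_integral_cong_AE)
    from v_pos AE_space show "AE x in L. ennreal (\<sigma> x * s x powr (p' * \<beta>)) =
       ennreal (v x) epowr (1 - p') * ennreal (s x) epowr (p' * \<beta>) * indicator J x"
    proof eventually_elim
      case (elim x)
      then have "s x > 0" using s_pos by (simp add: space_L)
      with elim show ?case
        by (auto simp: \<sigma>_def epowr_ennreal ennreal_mult split: split_indicator)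
    qed
  qed
  have adm: "admissible s f"
  proof -
    have f_int: "integrable L f"
      using moment[of "p' * \<beta> + \<delta> - 1"] by (simp add: integrable_iff_bounded cmod_f)
    have "loc_integrable f"
      unfolding loc_integrable_def set_integrable_def
    proof (intro allI impI)
      fix r :: real assume "0 < r"
      have "integrable L (\<lambda>x. indicator {0<..r} x *\<^sub>R f x)"
        using f_int by (rule integrable_mult_indicator[rotated]) (auto simp: L_def sets_restrict_space_iff)
      then have "integrable lebesgue (\<lambda>x. indicator {0<..} x *\<^sub>R indicator {0<..r} x *\<^sub>R f x)"
        unfolding L_def by (subst (asm) integrable_restrict_space) auto
      moreover have "(\<lambda>x. indicator {0<..} x *\<^sub>R indicator {0<..r} x *\<^sub>R f x) = (\<lambda>x. indicator {0<..r} x *\<^sub>R f x)"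
        by (auto simp: fun_eq_iff split: split_indicator)
      ultimately show "integrable lebesgue (\<lambda>x. indicator {0<..r} x *\<^sub>R f x)" by simp
    qed
    moreover have weighted: "(\<integral>\<^sup>+x\<in>A. ennreal (t x * cmod (f x)) \<partial>lebesgue) < \<infinity>"
      if A: "A \<subseteq> {0<..}" and t: "\<And>x. x > 0 \<Longrightarrow> t x = s x powr r" for A r t
    proof -
      have "(\<integral>\<^sup>+x\<in>A. ennreal (t x * cmod (f x)) \<partial>lebesgue)
          \<le> (\<integral>\<^sup>+x. ennreal (\<sigma> x * s x powr (p' * \<beta> + \<delta> - 1 + r)) \<partial>L)"
        unfolding nn_integral_over_half_line[OF A] L_def[symmetric]
        by (intro nn_integral_mono) (auto simp: t s_f space_L split: split_indicator)
      also have "\<dots> < \<infinity>" by (rule moment)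
      finally show ?thesis .
    qed
    have "(\<integral>\<^sup>+x\<in>{0<..1}. ennreal (s x * cmod (f x)) \<partial>lebesgue) < \<infinity>"
      by (rule weighted[where r = 1]) (use s_pos in \<open>auto simp: less_imp_le\<close>)
    moreover have "(\<integral>\<^sup>+x\<in>{1<..}. ennreal (sqrt (s x) * cmod (f x)) \<partial>lebesgue) < \<infinity>"
      by (rule weighted[where r = "1/2"]) (use s_pos in \<open>auto simp: less_imp_le powr_half_sqrt\<close>)
    ultimately show ?thesis by (simp add: admissible_def flip: L_def)
  qed
  have lower: "ennreal c * ennreal (w y powr (- \<delta>)) * \<Sigma> \<le> ennreal (cmod (transform s K f y))"
    if y: "y \<in> E" for y
  proof -
    define h where "h x = \<sigma> x * s x powr (p' * \<beta> + \<delta>) * K x y" for x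
    have y0: "y > 0" using E_pos y .
    have [measurable]: "h \<in> borel_measurable L" unfolding h_def using K_meas[OF y0] by measurable
    have h_nonneg: "0 \<le> h x" if "x > 0" for x
      using \<sigma>_nonneg K_nonneg[OF that y0] by (simp add: h_def)
    have h_int: "integrable L h"
    proof -
      have "(\<integral>\<^sup>+x. ennreal (norm (h x)) \<partial>L)
          \<le> (\<integral>\<^sup>+x. ennreal Cmax * ennreal (\<sigma> x * s x powr (p' * \<beta> + \<delta>)) \<partial>L)"
      proof (rule nn_integral_mono)
        fix x assume "x \<in> space L"
        then have x: "x > 0" by (simp add: space_L)
        have "norm (h x) = h x" using h_nonneg[OF x] by simp
        also have "\<dots> \<le> Cmax * (\<sigma> x * s x powr (p' * \<beta> + \<delta>))"
          using \<sigma>_nonneg[of x] K_le[OF x y0]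
          unfolding h_def by (subst mult.commute) (intro mult_right_mono, auto)
        finally show "ennreal (norm (h x)) \<le> ennreal Cmax * ennreal (\<sigma> x * s x powr (p' * \<beta> + \<delta>))"
          using K_nonneg[OF x y0] K_le[OF x y0] \<sigma>_nonneg[of x] by (simp flip: ennreal_mult)
      qed
      also have "\<dots> = ennreal Cmax * (\<integral>\<^sup>+x. ennreal (\<sigma> x * s x powr (p' * \<beta> + \<delta>)) \<partial>L)"
        by (rule nn_integral_cmult) simp
      also have "\<dots> < \<infinity>" using moment by (simp add: ennreal_mult_less_top)
      finally show ?thesis by (simp add: integrable_iff_bounded)
    qed
    have "transform s K f y = (\<integral>x. of_real (s x) * f x * of_real (K x y) \<partial>L)"
      by (simp add: transform_def set_lebesgue_integral_def L_def integral_restrict_space)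
    also have "\<dots> = (\<integral>x. of_real (h x) \<partial>L)"
    proof (intro Bochner_Integration.integral_cong refl)
      fix x assume "x \<in> space L"
      then have "s x > 0" using s_pos by (simp add: space_L)
      then have "s x * s x powr (p' * \<beta> + \<delta> - 1) = s x powr (p' * \<beta> + \<delta>)"
        by (simp add: powr_diff)
      then show "complex_of_real (s x) * f x * of_real (K x y) = of_real (h x)"
        unfolding f_def h_def of_real_mult[symmetric] of_real_eq_iff by (simp add: ac_simps)
    qed
    also have "\<dots> = of_real (\<integral>x. h x \<partial>L)" by simp
    finally have "cmod (transform s K f y) = \<bar>\<integral>x. h x \<partial>L\<bar>" by simp
    also have "\<dots> = (\<integral>x. h x \<partial>L)"
      using h_nonneg by (intro abs_of_nonneg integral_nonneg_AE AE_I2) (simp add: space_L)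
    finally have "ennreal (cmod (transform s K f y)) = (\<integral>\<^sup>+x. ennreal (h x) \<partial>L)"
      using h_int h_nonneg by (subst nn_integral_eq_integral) (auto simp: space_L intro!: AE_I2)
    also have "\<dots> \<ge> (\<integral>\<^sup>+x. ennreal (c * w y powr (- \<delta>)) * ennreal (\<sigma> x * s x powr (p' * \<beta>)) \<partial>L)"
    proof (rule nn_integral_mono)
      fix x assume "x \<in> space L"
      show "ennreal (c * w y powr (- \<delta>)) * ennreal (\<sigma> x * s x powr (p' * \<beta>)) \<le> ennreal (h x)"
      proof (cases "x \<in> J")
        case True
        have sx: "s x > 0" "w y > 0" using s_pos J_pos True w_pos y0 by auto
        have "c * w y powr (- \<delta>) * (\<sigma> x * s x powr (p' * \<beta>))
          = \<sigma> x * s x powr (p' * \<beta> + \<delta>) * (c * (s x * w y) powr (- \<delta>))"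
          using sx by (simp add: powr_mult powr_add powr_minus field_simps)
        also have "\<dots> \<le> h x"
          unfolding h_def using K_ge[OF True y] \<sigma>_nonneg by (intro mult_left_mono) auto
        finally show ?thesis using c \<sigma>_nonneg[of x] by (simp flip: ennreal_mult add: ennreal_leI)
      qed (simp add: \<sigma>_def)
    qed
    finally show ?thesis
      using c by (simp add: nn_integral_cmult \<Sigma>_def ennreal_mult)
  qed
  let ?U = "\<integral>\<^sup>+y\<in>E. ennreal (u y) * ennreal (w y) epowr (q * \<beta>) \<partial>L"
  have "ennreal c * \<Sigma> * ?U epowr (1/q) \<le> wnorm q u (\<lambda>y. of_real (w y powr \<beta>0) * transform s K f y)"
  proof -
    have "(ennreal c * \<Sigma>) epowr q * ?U
        = (\<integral>\<^sup>+y. (ennreal c * \<Sigma>) epowr q * (ennreal (u y) * ennreal (w y) epowr (q * \<beta>) * indicator E y) \<partial>L)"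
      by (rule nn_integral_cmult[symmetric]) simp
    also have "\<dots> \<le> (\<integral>\<^sup>+y. ennreal (u y) * ennreal (cmod (of_real (w y powr \<beta>0) * transform s K f y)) epowr q \<partial>L)"
    proof (rule nn_integral_mono)
      fix y assume "y \<in> space L"
      show "(ennreal c * \<Sigma>) epowr q * (ennreal (u y) * ennreal (w y) epowr (q * \<beta>) * indicator E y)
          \<le> ennreal (u y) * ennreal (cmod (of_real (w y powr \<beta>0) * transform s K f y)) epowr q"
      proof (cases "y \<in> E")
        case True
        then have wy: "w y > 0" using E_pos w_pos by blast
        have "ennreal (w y) epowr (q * \<beta>) = ennreal (w y powr \<beta>) epowr q"
          using wy by (simp add: epowr_ennreal powr_powr mult.commute)
        then have "(ennreal c * \<Sigma>) epowr q * ennreal (w y) epowr (q * \<beta>)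
            = (ennreal (w y powr \<beta>0) * (ennreal c * ennreal (w y powr (- \<delta>)) * \<Sigma>)) epowr q"
          using q by (simp add: epowr_mult \<beta> powr_diff powr_minus divide_inverse ennreal_mult ac_simps)
        also have "\<dots> \<le> (ennreal (w y powr \<beta>0) * ennreal (cmod (transform s K f y))) epowr q"
          using q lower[OF True] by (intro epowr_mono mult_left_mono) auto
        also have "\<dots> = ennreal (cmod (of_real (w y powr \<beta>0) * transform s K f y)) epowr q"
          by (simp add: norm_mult ennreal_mult)
        finally show ?thesis using True by (simp add: mult_left_mono mult.left_commute)
      qed simp
    qed
    finally have "((ennreal c * \<Sigma>) epowr q * ?U) epowr (1/q)
        \<le> wnorm q u (\<lambda>y. of_real (w y powr \<beta>0) * transform s K f y)"
      unfolding wnorm_half_line L_def[symmetric] using q by (intro epowr_mono) auto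
    then show ?thesis using q by (simp add: epowr_mult epowr_epowr)
  qed
  also have "\<dots> \<le> ennreal C * wnorm p v (\<lambda>x. of_real (s x powr \<alpha>) * f x)"
    by (rule ineq[OF adm])
  also have "wnorm p v (\<lambda>x. of_real (s x powr \<alpha>) * f x) = \<Sigma> epowr (1/p)"
  proof -
    have "(\<integral>\<^sup>+x. ennreal (v x) * ennreal (cmod (of_real (s x powr \<alpha>) * f x)) epowr p \<partial>L) = \<Sigma>"
      unfolding \<Sigma>_def
    proof (rule nn_integral_cong_AE)
      from v_pos AE_space show "AE x in L. ennreal (v x) * ennreal (cmod (of_real (s x powr \<alpha>) * f x)) epowr p
          = ennreal (\<sigma> x * s x powr (p' * \<beta>))"
      proof eventually_elim
        case (elim x)
        then have x: "x > 0" "s x > 0" using s_pos by (auto simp: space_L)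
        have "cmod (of_real (s x powr \<alpha>) * f x) = \<sigma> x * s x powr (p' * \<beta> - \<beta>)"
        proof -
          have e: "p' * \<beta> + \<delta> - 1 + \<alpha> = p' * \<beta> - \<beta>" using \<alpha> \<beta> by linarith
          show ?thesis using s_f[OF x(1), of \<alpha>] unfolding e by (simp add: norm_mult)
        qed
        moreover have "v x * (v x powr (1 - p') * s x powr (p' * \<beta> - \<beta>)) powr p = v x powr (1 - p') * s x powr (p' * \<beta>)"
        proof -
          have e: "1 + (1 - p') * p = 1 - p'" "(p' * \<beta> - \<beta>) * p = p' * \<beta>"
            using p'(2) by (simp_all add: algebra_simps) (metis add_diff_cancel_left' distrib_left mult.commute)
          have "v x * (v x powr (1 - p') * s x powr (p' * \<beta> - \<beta>)) powr p
             = v x powr 1 * v x powr ((1 - p') * p) * s x powr ((p' * \<beta> - \<beta>) * p)"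
            using elim x by (simp add: powr_mult powr_powr)
          also have "\<dots> = v x powr (1 - p') * s x powr (p' * \<beta>)"
            unfolding powr_add[symmetric] e ..
          finally show ?thesis .
        qed
        ultimately show ?case
          using x pos elim by (auto simp: \<sigma>_def epowr_ennreal_pos_exponent simp flip: ennreal_mult split: split_indicator)
      qed
    qed
    then show ?thesis
      by (simp add: wnorm_half_line L_def)
  qed
  finally have *: "ennreal c * \<Sigma> * ?U epowr (1/q) \<le> ennreal C * \<Sigma> epowr (1/p)" .
  show ?thesis unfolding \<Sigma>_eq[symmetric]
  proof (cases "\<Sigma> = 0")
    case True
    then show "?U epowr (1/q) * \<Sigma> epowr (1/p') \<le> ennreal (C / c)" using pos by simp
  next
    case False
    let ?T = "\<Sigma> epowr (1/p)"
    have T: "?T \<noteq> 0" "?T \<noteq> top"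
      using False pos moment[of "p' * \<beta>"] epowr_eq_0_iff[of "1/p" \<Sigma>] epowr_eq_top_iff[of "1/p" \<Sigma>]
      by (auto simp: \<Sigma>_def)
    have factor: "?T * \<Sigma> epowr (1/p') = \<Sigma>"
      using epowr_add[of "1/p" "1/p'" \<Sigma>] pos p by simp
    have "?T * (ennreal c * (?U epowr (1/q) * \<Sigma> epowr (1/p')))
        = ennreal c * (?T * \<Sigma> epowr (1/p')) * ?U epowr (1/q)"
      by (simp only: ac_simps)
    also have "\<dots> = ennreal c * \<Sigma> * ?U epowr (1/q)" by (simp only: factor)
    also have "\<dots> \<le> ?T * ennreal C" using * by (simp add: mult.commute)
    finally have "ennreal c * (?U epowr (1/q) * \<Sigma> epowr (1/p')) \<le> ennreal C"
      using T by (simp add: ennreal_mult_le_mult_iff)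
    also have "ennreal C = ennreal c * ennreal (C / c)" using c C by (simp flip: ennreal_mult)
    finally show "?U epowr (1/q) * \<Sigma> epowr (1/p') \<le> ennreal (C / c)"
      using c by (simp add: ennreal_mult_le_mult_iff)
  qed
qed

section \<open>The characterisation\<close>

lemma rec_exp_add:
  assumes "1 / a + 1 / a' = 1" shows "rec_exp a + rec_exp a' = 1"
proof -
  have "1 / a < top" "1 / a' < top"
    using assms by (metis ennreal_add_eq_top ennreal_one_less_top less_top)+
  then show ?thesis
    unfolding rec_exp_def using assms by (metis enn2real_1 enn2real_plus)
qed

text \<open>Since \<open>1 - p' < 0\<close>, the power \<open>v epowr (1 - p')\<close> is infinite at the zeros of \<open>v\<close>, and a
  function with finite integral is finite almost everywhere.\<close>
lemma AE_pos_if_nn_loc_integrable: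
  assumes loc: "nn_loc_integrable (\<lambda>x. ennreal (v x) epowr (1 - p') * ennreal (s x) epowr r)"
    and p': "1 < p'" and s_pos: "\<And>x. x > 0 \<Longrightarrow> 0 < s x"
    and v_nonneg: "\<And>x. x > 0 \<Longrightarrow> 0 \<le> v x"
  shows "AE x in lebesgue_on {0<..}. 0 < v x"
proof -
  let ?L = "lebesgue_on {0<..} :: real measure"
  let ?h = "\<lambda>x. ennreal (v x) epowr (1 - p') * ennreal (s x) epowr r"
  have [measurable]: "?h \<in> borel_measurable ?L" using loc by (simp add: nn_loc_integrable_def)
  have "AE x in ?L. \<forall>n::nat. ?h x * indicator {0<..real (Suc n)} x \<noteq> \<infinity>"
  proof (subst AE_all_countable, intro allI nn_integral_PInf_AE)
    fix n :: nat
    have [measurable]: "{0<..real (Suc n)} \<in> sets ?L" by (auto simp: sets_restrict_space_iff)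
    show "(\<lambda>x. ?h x * indicator {0<..real (Suc n)} x) \<in> borel_measurable ?L" by measurable
    show "(\<integral>\<^sup>+x\<in>{0<..real (Suc n)}. ?h x \<partial>?L) \<noteq> \<infinity>"
      using nn_loc_integrable_half_line[OF loc, of "real (Suc n)"] by simp
  qed
  with AE_space show ?thesis
  proof eventually_elim
    case (elim x)
    then have x: "x > 0" by simp
    obtain n :: nat where "x \<le> real (Suc n)" by (meson le_SucI of_nat_mono order_trans real_arch_simple order.refl)
    then have "?h x \<noteq> \<infinity>" using elim x by (metis greaterThanAtMost_iff indicator_simps(1) mult.right_neutral)
    then show "0 < v x"
      using v_nonneg[OF x] s_pos[OF x] p' by (cases "v x = 0") (auto simp: epowr_def)
  qed
qed

theorem corollary1p4:
  fixes s w u v :: "real \<Rightarrow> real" and K :: "real \<Rightarrow> real \<Rightarrow> real"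
    and p q p' :: real and a a' :: ennreal
  assumes s_nonneg: "\<forall>x>0. 0 \<le> s x" and s_mono: "mono_on {0<..} s"
    and w_nonneg: "\<forall>y>0. 0 \<le> w y" and w_mono: "mono_on {0<..} w"
    and s_loc: "loc_integrable s"
    and s_w: "comparable_on {0<..} (\<lambda>x. s x * w (1 / x)) (\<lambda>_. 1)"
    and K_cont: "continuous_on ({0<..} \<times> {0<..}) (\<lambda>(x, y). K x y)"
    and K_est: "comparable_on ({0<..} \<times> {0<..}) (\<lambda>(x, y). K x y)
                  (\<lambda>(x, y). min 1 ((s x * w y) powr (- 1 / 2)))"
    and pq: "1 < p" "p \<le> q" and p': "1 / p + 1 / p' = 1"
    and a: "1 \<le> a" and a': "1 / a + 1 / a' = 1"
    and u_nonneg: "\<forall>y>0. 0 \<le> u y" and u_meas: "u \<in> borel_measurable (lebesgue_on {0<..})"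
    and v_nonneg: "\<forall>x>0. 0 \<le> v x" and v_meas: "v \<in> borel_measurable (lebesgue_on {0<..})"
    and u_loc: "nn_loc_integrable (\<lambda>y. ennreal (u y) * ennreal (w y) epowr (q * rec_exp a'))"
    and v_loc: "nn_loc_integrable
                  (\<lambda>x. ennreal (v x) epowr (1 - p') * ennreal (s x) epowr (p' * rec_exp a'))"
  shows
    "(\<exists>C>0. \<forall>f. admissible s f \<longrightarrow>
        wnorm q u (\<lambda>y. of_real (w y powr rec_exp a') * transform s K f y)
          \<le> ennreal C * wnorm p v (\<lambda>x. of_real (s x powr rec_exp a) * f x))
     \<longleftrightarrow>
     (\<exists>C>0.
        (SUP r\<in>{0<..}.
           (\<integral>\<^sup>+y\<in>{0<..<1 / r}. ennreal (u y) * ennreal (w y) epowr (q * rec_exp a') \<partial>lebesgue)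
             epowr (1 / q)
           * (\<integral>\<^sup>+x\<in>{0<..<r}. ennreal (v x) epowr (1 - p')
                * ennreal (s x) epowr (p' * rec_exp a') \<partial>lebesgue) epowr (1 / p'))
          \<le> ennreal C
        \<and>
        (SUP r\<in>{0<..}.
           (\<integral>\<^sup>+y\<in>{1 / r<..}. ennreal (u y)
                * ennreal (w y) epowr (q * (rec_exp a' - 1 / 2)) \<partial>lebesgue) epowr (1 / q)
           * (\<integral>\<^sup>+x\<in>{r<..}. ennreal (v x) epowr (1 - p')
                * ennreal (s x) epowr (p' * (rec_exp a' - 1 / 2)) \<partial>lebesgue) epowr (1 / p'))
          \<le> ennreal C)" (is "?inequality \<longleftrightarrow> ?conditions")
proof -
  define L where "L = (lebesgue_on {0<..} :: real measure)"
  define \<alpha> where "\<alpha> = rec_exp a"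
  define \<beta> where "\<beta> = rec_exp a'"
  have space_L: "space L = {0<..}" by (simp add: L_def)
  have \<alpha>\<beta>: "\<alpha> + \<beta> = 1" using rec_exp_add[OF a'] by (simp add: \<alpha>_def \<beta>_def)
  have p'1: "1 < p'" using conjugate_exponent[OF pq(1) p'] by simp
  have pos: "0 < p" "0 < q" "0 < p'" using pq p'1 by auto
  have sw: "0 < s x * w (1/x)" if "x > 0" for x
    using s_w that unfolding comparable_on_def by (force intro: less_le_trans)
  have s_pos: "0 < s x" if "x > 0" for x
    using sw[OF that] s_nonneg w_nonneg that by (simp add: zero_less_mult_iff order_less_le)
  have w_pos: "0 < w y" if "y > 0" for y
    using sw[of "1/y"] s_nonneg w_nonneg that by (simp add: zero_less_mult_iff order_less_le)
  have v0: "0 \<le> v x" if "x > 0" for x using v_nonneg that by blast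
  have v_pos: "AE x in L. 0 < v x"
    unfolding L_def by (rule AE_pos_if_nn_loc_integrable[OF v_loc p'1 s_pos v0])
  have [measurable]: "s \<in> borel_measurable L" "w \<in> borel_measurable L"
      "u \<in> borel_measurable L" "v \<in> borel_measurable L"
    using borel_measurable_half_line_mono s_mono w_mono u_meas v_meas by (simp_all add: L_def)
  have id_meas [measurable]: "(\<lambda>x. x) \<in> borel_measurable L"
    unfolding L_def by (intro measurable_restrict_space1 measurable_completion) simp
  have K_meas: "(\<lambda>x. K x y) \<in> borel_measurable L" if "y > 0" for y
  proof -
    have "continuous_on {0<..} (\<lambda>x. (\<lambda>(x, y). K x y) (x, y))"
      using that by (intro continuous_on_compose2[OF K_cont]) (auto intro!: continuous_intros)
    then show ?thesis
      unfolding L_def by (intro continuous_imp_measurable_on_sets_lebesgue) auto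
  qed
  obtain c Cmax where kernel: "0 < c" "0 < Cmax"
    "\<And>x y. x > 0 \<Longrightarrow> y > 0 \<Longrightarrow> x * y \<le> 1 \<Longrightarrow> c \<le> K x y"
    "\<And>x y. x > 0 \<Longrightarrow> y > 0 \<Longrightarrow> 1 \<le> x * y \<Longrightarrow> c * (s x * w y) powr (- 1 / 2) \<le> K x y"
    "\<And>x y. x > 0 \<Longrightarrow> y > 0 \<Longrightarrow> 0 \<le> K x y"
    "\<And>x y. x > 0 \<Longrightarrow> y > 0 \<Longrightarrow> K x y \<le> Cmax"
    "\<And>x y. x > 0 \<Longrightarrow> y > 0 \<Longrightarrow> K x y \<le> Cmax * (s x * w y) powr (- 1 / 2)"
    using kernel_two_regimes[OF s_pos w_pos w_mono s_w K_est] by blast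
  define U where "U \<beta>' A = (\<integral>\<^sup>+y\<in>A. ennreal (u y) * ennreal (w y) epowr (q * \<beta>') \<partial>L) epowr (1 / q)"
    for \<beta>' and A :: "real set"
  define S where "S \<beta>' A = (\<integral>\<^sup>+x\<in>A. ennreal (v x) epowr (1 - p') * ennreal (s x) epowr (p' * \<beta>') \<partial>L) epowr (1 / p')"
    for \<beta>' and A :: "real set"
  have sub: "{0<..<r} \<subseteq> {0<..}" "r > 0 \<Longrightarrow> {r<..} \<subseteq> {0<..}" for r :: real by auto
  have conditions_iff: "?conditions \<longleftrightarrow> (\<exists>C>0. \<forall>r>0.
      U \<beta> {0<..<1 / r} * S \<beta> {0<..<r} \<le> ennreal C \<and>
      U (\<beta> - 1/2) {1 / r<..} * S (\<beta> - 1/2) {r<..} \<le> ennreal C)"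
    unfolding SUP_le_iff U_def S_def \<beta>_def L_def
    by (intro ex_cong1 conj_cong refl) (auto simp: nn_integral_over_half_line sub)
  have sets_L: "A \<in> sets L" if "A \<subseteq> {0<..}" "A \<in> sets borel" for A
    using that unfolding L_def by (auto simp: sets_restrict_space_iff intro: sets_completionI_sets)
  show ?thesis unfolding conditions_iff
  proof
    assume ?inequality
    then obtain C where C: "C > 0" and ineq: "\<And>f. admissible s f \<Longrightarrow>
        wnorm q u (\<lambda>y. of_real (w y powr \<beta>) * transform s K f y)
          \<le> ennreal C * wnorm p v (\<lambda>x. of_real (s x powr \<alpha>) * f x)"
      by (auto simp: \<alpha>_def \<beta>_def)
    note test = test_function_bound[OF pq(1) p' pos(2) \<alpha>\<beta> _ s_pos w_pos s_mono w_mono v0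
        v_pos[unfolded L_def] u_meas v_meas v_loc[folded \<beta>_def] K_meas[unfolded L_def] kernel(5,6) ineq,
        folded L_def]
    show "\<exists>C>0. \<forall>r>0. U \<beta> {0<..<1 / r} * S \<beta> {0<..<r} \<le> ennreal C \<and>
      U (\<beta> - 1/2) {1 / r<..} * S (\<beta> - 1/2) {r<..} \<le> ennreal C"
    proof (intro exI[of _ "C / c"] conjI allI impI)
      show "0 < C / c" using C kernel(1) by simp
      fix r :: real assume r: "r > 0"
      show "U \<beta> {0<..<1 / r} * S \<beta> {0<..<r} \<le> ennreal (C / c)"
        unfolding S_def
      proof (rule mult_epowr_nn_integral_le_if_upper_parts_le[where \<eta> = "\<lambda>x. x"])
        show "{0<..<r} \<in> sets L" by (rule sets_L) auto
        fix t assume t: "t \<in> {0<..<r}"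
        \<comment> \<open>Here \<open>x * y \<le> 1\<close>, so the kernel is bounded below by a constant: \<open>\<delta> = 0\<close>.\<close>
        show "U \<beta> {0<..<1 / r} * (\<integral>\<^sup>+x\<in>{z \<in> {0<..<r}. t \<le> z}.
            ennreal (v x) epowr (1 - p') * ennreal (s x) epowr (p' * \<beta>) \<partial>L) epowr (1 / p') \<le> ennreal (C / c)"
          unfolding U_def
        proof (rule test[where \<delta> = 0 and a = t and b = r])
          have "{z \<in> {0<..<r}. t \<le> z} = {t..<r}" using t by auto
          moreover have "{t..<r} \<in> sets L" using t by (intro sets_L) auto
          ultimately show "{z \<in> {0<..<r}. t \<le> z} \<in> sets L" by (simp only:)
          show "{0<..<1 / r} \<in> sets L" by (rule sets_L) auto
          fix x y assume "x \<in> {z \<in> {0<..<r}. t \<le> z}" "y \<in> {0<..<1 / r}"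
          then have xy: "x > 0" "y > 0" "x < r" "y < 1 / r" by auto
          then have "x * y \<le> r * (1 / r)" by (intro mult_mono) auto
          then have "x * y \<le> 1" using r by simp
          then show "c * (s x * w y) powr (- 0) \<le> K x y"
            using kernel(3)[of x y] xy s_pos[of x] w_pos[of y] by simp
        qed (use t C kernel(1) in auto)
      qed (use pos in auto)
      show "U (\<beta> - 1/2) {1 / r<..} * S (\<beta> - 1/2) {r<..} \<le> ennreal (C / c)"
        unfolding S_def
      proof (rule mult_epowr_nn_integral_le_if_upper_parts_le[where \<eta> = "\<lambda>x. - x"])
        show "{r<..} \<in> sets L" using r by (intro sets_L) auto
        fix t assume t: "t \<in> {r<..}"
        \<comment> \<open>Here \<open>x * y \<ge> 1\<close>, so the kernel decays like \<open>(s x * w y) powr (- 1/2)\<close>.\<close>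
        show "U (\<beta> - 1/2) {1 / r<..} * (\<integral>\<^sup>+x\<in>{z \<in> {r<..}. - t \<le> - z}.
            ennreal (v x) epowr (1 - p') * ennreal (s x) epowr (p' * (\<beta> - 1/2)) \<partial>L) epowr (1 / p') \<le> ennreal (C / c)"
          unfolding U_def
        proof (rule test[where \<delta> = "1/2" and a = r and b = t])
          have "{z \<in> {r<..}. - t \<le> - z} = {r<..t}" by auto
          moreover have "{r<..t} \<in> sets L" using r by (intro sets_L) auto
          ultimately show "{z \<in> {r<..}. - t \<le> - z} \<in> sets L" by (simp only:)
          show "{1 / r<..} \<in> sets L" using r by (intro sets_L) (auto intro: less_trans[of 0 "1/r"])
          fix x y assume "x \<in> {z \<in> {r<..}. - t \<le> - z}" "y \<in> {1 / r<..}"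
          then have xy: "r < x" "1 / r < y" by auto
          moreover from xy r have "x > 0" "y > 0" by (auto intro: less_trans[of 0 "1/r"])
          moreover have "r * (1 / r) \<le> x * y" using xy r by (intro mult_mono) auto
          then have "1 \<le> x * y" using r by simp
          ultimately show "c * (s x * w y) powr (- (1/2)) \<le> K x y"
            using kernel(4)[of x y] by simp
        qed (use r C kernel(1) in auto)
      qed (use pos in auto)
    qed
  next
    assume "\<exists>C>0. \<forall>r>0. U \<beta> {0<..<1 / r} * S \<beta> {0<..<r} \<le> ennreal C \<and>
      U (\<beta> - 1/2) {1 / r<..} * S (\<beta> - 1/2) {r<..} \<le> ennreal C"
    then obtain C where C: "C > 0"
      and near: "\<And>r. r > 0 \<Longrightarrow> U \<beta> {0<..<1 / r} * S \<beta> {0<..<r} \<le> ennreal C"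
      and far: "\<And>r. r > 0 \<Longrightarrow> U (\<beta> - 1/2) {1 / r<..} * S (\<beta> - 1/2) {r<..} \<le> ennreal C"
      by blast
    \<comment> \<open>Hardy's inequality is stated with closed half-lines, the conditions with open ones;
        the difference is a single point.\<close>
    have U_cong: "U \<beta>' A = U \<beta>' B" if "\<And>y. y > 0 \<Longrightarrow> y \<noteq> t \<Longrightarrow> y \<in> A \<longleftrightarrow> y \<in> B" for \<beta>' A B t
      unfolding U_def
    proof (intro arg_cong[where f = "\<lambda>z. z epowr (1/q)"] nn_integral_cong_AE)
      from AE_half_line_neq[of t, folded L_def] AE_space
      show "AE y in L. ennreal (u y) * ennreal (w y) epowr (q * \<beta>') * indicator A y
         = ennreal (u y) * ennreal (w y) epowr (q * \<beta>') * indicator B y"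
        by eventually_elim (use that in \<open>auto simp: space_L split: split_indicator\<close>)
    qed
    have S_cong: "S \<beta>' A = S \<beta>' B" if "\<And>y. y > 0 \<Longrightarrow> y \<noteq> t \<Longrightarrow> y \<in> A \<longleftrightarrow> y \<in> B" for \<beta>' A B t
      unfolding S_def
    proof (intro arg_cong[where f = "\<lambda>z. z epowr (1/p')"] nn_integral_cong_AE)
      from AE_half_line_neq[of t, folded L_def] AE_space
      show "AE y in L. ennreal (v y) epowr (1 - p') * ennreal (s y) epowr (p' * \<beta>') * indicator A y
         = ennreal (v y) epowr (1 - p') * ennreal (s y) epowr (p' * \<beta>') * indicator B y"
        by eventually_elim (use that in \<open>auto simp: space_L split: split_indicator\<close>)
    qed
    define A where "A = 4 epowr q * 2 epowr (q / p) * ennreal C epowr q"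
    define D where "D = ennreal Cmax epowr q * (2 epowr q * (2 * A))"
    have D: "0 < D epowr (1/q)" "D epowr (1/q) < top"
    proof -
      have "A \<noteq> 0" "A \<noteq> top"
        using C pos epowr_eq_0_iff epowr_eq_top_iff by (auto simp: A_def ennreal_mult_eq_top_iff)
      then have "D \<noteq> 0" "D \<noteq> top"
        using kernel(2) pos epowr_eq_0_iff epowr_eq_top_iff
        by (auto simp: D_def ennreal_mult_eq_top_iff)
      then show "0 < D epowr (1/q)" "D epowr (1/q) < top"
        using pos epowr_eq_0_iff[of "1/q" D] epowr_eq_top_iff[of "1/q" D]
        by (auto simp: zero_less_iff_neq_zero less_top)
    qed
    show ?inequality
    proof (intro exI[of _ "enn2real (D epowr (1/q))"] conjI allI impI)
      show "0 < enn2real (D epowr (1/q))" using D by (simp add: enn2real_positive_iff)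
      fix f assume "admissible s f"
      then have [measurable]: "f \<in> borel_measurable L" by (simp add: admissible_def L_def)
      define I where "I = (\<integral>\<^sup>+x. ennreal (v x) * ennreal (s x powr \<alpha> * cmod (f x)) epowr p \<partial>L)"
      define \<Phi>1 where "\<Phi>1 y = (\<integral>\<^sup>+x\<in>{x. x \<le> 1 / y}. ennreal (s x powr (\<alpha> + \<beta>) * cmod (f x)) \<partial>L)" for y
      define \<Phi>2 where "\<Phi>2 y = (\<integral>\<^sup>+x\<in>{x. - x \<le> - (1 / y)}. ennreal (s x powr (\<alpha> + (\<beta> - 1/2)) * cmod (f x)) \<partial>L)" for y
      have [measurable]: "\<Phi>1 \<in> borel_measurable L" "\<Phi>2 \<in> borel_measurable L"
        unfolding \<Phi>1_def[abs_def] \<Phi>2_def[abs_def]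
        by (rule borel_measurable_integral_up_to, measurable)+
      note Hardy = Hardy_for_power_weights[where s = s and w = w and u = u and v = v and B = "ennreal C"
          and F = "\<lambda>x. cmod (f x)" and \<alpha> = \<alpha>, OF pq(1) p' pq(2) s_pos w_pos v0
          v_pos[unfolded L_def], folded L_def]
      have H1: "(\<integral>\<^sup>+y. ennreal (u y) * (ennreal (w y powr \<beta>) * \<Phi>1 y) epowr q \<partial>L) \<le> A * I epowr (q / p)"
        unfolding \<Phi>1_def A_def I_def
      proof (rule Hardy)
        fix y :: real assume y: "y > 0"
        have "U \<beta> {z. 1 / y \<le> 1 / z} = U \<beta> {0<..<1 / (1 / y)}"
          using y by (intro U_cong[of y]) (auto simp: field_simps)
        moreover have "S \<beta> {x. x \<le> 1 / y} = S \<beta> {0<..<1 / y}"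
          by (intro S_cong[of "1 / y"]) auto
        ultimately show "(\<integral>\<^sup>+z\<in>{z. 1 / y \<le> 1 / z}. ennreal (u z) * ennreal (w z) epowr (q * \<beta>) \<partial>L) epowr (1 / q)
          * (\<integral>\<^sup>+x\<in>{x. x \<le> 1 / y}. ennreal (v x) epowr (1 - p') * ennreal (s x) epowr (p' * \<beta>) \<partial>L) epowr (1 / p')
          \<le> ennreal C"
          using near[of "1 / y"] y unfolding U_def S_def by simp
      qed (use C in auto)
      have H2: "(\<integral>\<^sup>+y. ennreal (u y) * (ennreal (w y powr (\<beta> - 1/2)) * \<Phi>2 y) epowr q \<partial>L) \<le> A * I epowr (q / p)"
        unfolding \<Phi>2_def A_def I_def
      proof (rule Hardy)
        fix y :: real assume y: "y > 0"
        have "U (\<beta> - 1/2) {z. - (1 / y) \<le> - (1 / z)} = U (\<beta> - 1/2) {1 / (1 / y)<..}"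
          using y by (intro U_cong[of y]) (auto simp: field_simps)
        moreover have "S (\<beta> - 1/2) {x. - x \<le> - (1 / y)} = S (\<beta> - 1/2) {1 / y<..}"
          by (intro S_cong[of "1 / y"]) auto
        ultimately show "(\<integral>\<^sup>+z\<in>{z. - (1 / y) \<le> - (1 / z)}. ennreal (u z) * ennreal (w z) epowr (q * (\<beta> - 1/2)) \<partial>L) epowr (1 / q)
          * (\<integral>\<^sup>+x\<in>{x. - x \<le> - (1 / y)}. ennreal (v x) epowr (1 - p') * ennreal (s x) epowr (p' * (\<beta> - 1/2)) \<partial>L) epowr (1 / p')
          \<le> ennreal C"
          using far[of "1 / y"] y unfolding U_def S_def by simp
      qed (use C in auto)
      \<comment> \<open>The integral is cut at \<open>x = 1 / y\<close>, where the kernel changes regime.\<close>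
      have split: "ennreal (cmod (transform s K f y)) \<le> ennreal Cmax * (\<Phi>1 y + ennreal (w y powr (- (1/2))) * \<Phi>2 y)"
        if y: "y > 0" for y
      proof -
        let ?h = "\<lambda>x. of_real (s x) * f x * of_real (K x y)"
        have "transform s K f y = integral\<^sup>L L ?h"
          by (simp add: transform_def set_lebesgue_integral_def L_def integral_restrict_space)
        moreover have "ennreal (norm (integral\<^sup>L L ?h)) \<le> (\<integral>\<^sup>+x. norm (?h x) \<partial>L)"
          by (cases "integrable L ?h") (auto intro: integral_norm_bound_ennreal simp: not_integrable_integral_eq)
        ultimately have "ennreal (cmod (transform s K f y)) \<le> (\<integral>\<^sup>+x. norm (?h x) \<partial>L)" by simp
        also have "\<dots> \<le> (\<integral>\<^sup>+x. ennreal Cmax * (ennreal (s x powr (\<alpha> + \<beta>) * cmod (f x)) * indicator {x. x \<le> 1 / y} x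
            + ennreal (w y powr (- (1/2))) * (ennreal (s x powr (\<alpha> + (\<beta> - 1/2)) * cmod (f x)) * indicator {x. - x \<le> - (1 / y)} x)) \<partial>L)"
        proof (rule nn_integral_mono)
          fix x assume "x \<in> space L"
          then have x: "x > 0" by (simp add: space_L)
          have sx: "s x > 0" "w y > 0" using s_pos w_pos x y by auto
          have norm_h: "norm (?h x) = s x * cmod (f x) * K x y"
            using sx kernel(5)[OF x y] by (simp add: norm_mult)
          have ex: "\<alpha> + (\<beta> - 1/2) = 1/2" using \<alpha>\<beta> by simp
          show "ennreal (norm (?h x)) \<le> ennreal Cmax * (ennreal (s x powr (\<alpha> + \<beta>) * cmod (f x)) * indicator {x. x \<le> 1 / y} x
            + ennreal (w y powr (- (1/2))) * (ennreal (s x powr (\<alpha> + (\<beta> - 1/2)) * cmod (f x)) * indicator {x. - x \<le> - (1 / y)} x))"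
          proof (cases "x \<le> 1 / y")
            case True
            have "norm (?h x) \<le> Cmax * (s x * cmod (f x))"
              unfolding norm_h using kernel(6)[OF x y] sx
              by (subst mult.commute) (intro mult_right_mono, auto)
            then have "ennreal (norm (?h x)) \<le> ennreal Cmax * ennreal (s x powr (\<alpha> + \<beta>) * cmod (f x))"
              using kernel(2) sx \<alpha>\<beta> by (simp flip: ennreal_mult add: ennreal_leI)
            then show ?thesis
              using True by (elim order_trans) (intro mult_left_mono, auto intro: add_increasing2)
          next
            case False
            have "norm (?h x) \<le> Cmax * (s x * w y) powr (- 1/2) * (s x * cmod (f x))"
              unfolding norm_h using kernel(7)[OF x y] sx
              by (subst mult.commute) (intro mult_right_mono, auto)
            also have "\<dots> = Cmax * (w y powr (- (1/2)) * (s x powr (1/2) * cmod (f x)))"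
            proof -
              have "s x powr (- 1/2) * s x = s x powr (1/2)"
                using sx powr_add[of "s x" "- 1/2" 1] by simp
              then show ?thesis using sx by (simp add: powr_mult ac_simps)
            qed
            finally have "ennreal (norm (?h x)) \<le> ennreal (Cmax * (w y powr (- (1/2)) * (s x powr (1/2) * cmod (f x))))"
              by (rule ennreal_leI)
            also have "\<dots> = ennreal Cmax * (ennreal (w y powr (- (1/2))) * ennreal (s x powr (1/2) * cmod (f x)))"
              using kernel(2) by (simp add: ennreal_mult)
            finally show ?thesis using False unfolding ex by simp
          qed
        qed
        also have "\<dots> = ennreal Cmax * (\<Phi>1 y + ennreal (w y powr (- (1/2))) * \<Phi>2 y)"
          unfolding \<Phi>1_def \<Phi>2_def by (simp add: nn_integral_cmult nn_integral_add)
        finally show ?thesis .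
      qed
      have "(\<integral>\<^sup>+y. ennreal (u y) * ennreal (cmod (of_real (w y powr \<beta>) * transform s K f y)) epowr q \<partial>L)
        \<le> (\<integral>\<^sup>+y. ennreal Cmax epowr q * (2 epowr q *
             (ennreal (u y) * (ennreal (w y powr \<beta>) * \<Phi>1 y) epowr q
              + ennreal (u y) * (ennreal (w y powr (\<beta> - 1/2)) * \<Phi>2 y) epowr q)) \<partial>L)"
      proof (rule nn_integral_mono)
        fix y assume "y \<in> space L"
        then have y: "y > 0" by (simp add: space_L)
        have "ennreal (cmod (of_real (w y powr \<beta>) * transform s K f y))
            = ennreal (w y powr \<beta>) * ennreal (cmod (transform s K f y))"
          by (simp add: norm_mult ennreal_mult)
        also have "\<dots> \<le> ennreal (w y powr \<beta>) * (ennreal Cmax * (\<Phi>1 y + ennreal (w y powr (- (1/2))) * \<Phi>2 y))"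
          using split[OF y] by (rule mult_left_mono) simp
        also have "\<dots> = ennreal Cmax * (ennreal (w y powr \<beta>) * \<Phi>1 y + ennreal (w y powr (\<beta> - 1/2)) * \<Phi>2 y)"
        proof -
          have "ennreal (w y powr (\<beta> - 1/2)) = ennreal (w y powr \<beta>) * ennreal (w y powr (- (1/2)))"
            using powr_add[of "w y" \<beta> "- (1/2)"] by (simp flip: ennreal_mult)
          then show ?thesis by (simp only: distrib_left ac_simps)
        qed
        finally have "ennreal (cmod (of_real (w y powr \<beta>) * transform s K f y)) epowr q
            \<le> (ennreal Cmax * (ennreal (w y powr \<beta>) * \<Phi>1 y + ennreal (w y powr (\<beta> - 1/2)) * \<Phi>2 y)) epowr q"
          using pos by (intro epowr_mono) auto
        also have "\<dots> \<le> ennreal Cmax epowr q * (2 epowr q *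
            ((ennreal (w y powr \<beta>) * \<Phi>1 y) epowr q + (ennreal (w y powr (\<beta> - 1/2)) * \<Phi>2 y) epowr q))"
          unfolding epowr_mult[OF less_imp_le[OF pos(2)], of "ennreal Cmax"]
          using pos by (intro mult_left_mono epowr_add_le) auto
        finally have "ennreal (u y) * ennreal (cmod (of_real (w y powr \<beta>) * transform s K f y)) epowr q
           \<le> ennreal (u y) * (ennreal Cmax epowr q * (2 epowr q *
            ((ennreal (w y powr \<beta>) * \<Phi>1 y) epowr q + (ennreal (w y powr (\<beta> - 1/2)) * \<Phi>2 y) epowr q)))"
          by (rule mult_left_mono) simp
        then show "ennreal (u y) * ennreal (cmod (of_real (w y powr \<beta>) * transform s K f y)) epowr q
          \<le> ennreal Cmax epowr q * (2 epowr q *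
             (ennreal (u y) * (ennreal (w y powr \<beta>) * \<Phi>1 y) epowr q
              + ennreal (u y) * (ennreal (w y powr (\<beta> - 1/2)) * \<Phi>2 y) epowr q))"
          by (simp only: distrib_left ac_simps)
      qed
      also have "\<dots> = ennreal Cmax epowr q * (2 epowr q *
             ((\<integral>\<^sup>+y. ennreal (u y) * (ennreal (w y powr \<beta>) * \<Phi>1 y) epowr q \<partial>L)
              + (\<integral>\<^sup>+y. ennreal (u y) * (ennreal (w y powr (\<beta> - 1/2)) * \<Phi>2 y) epowr q \<partial>L)))"
        by (simp add: nn_integral_cmult nn_integral_add)
      also have "\<dots> \<le> ennreal Cmax epowr q * (2 epowr q * (A * I epowr (q/p) + A * I epowr (q/p)))"
        by (intro mult_left_mono add_mono H1 H2) auto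
      also have "\<dots> = D * I epowr (q/p)"
        by (simp add: D_def mult_2 distrib_left distrib_right mult.assoc)
      finally have main: "(\<integral>\<^sup>+y. ennreal (u y) * ennreal (cmod (of_real (w y powr \<beta>) * transform s K f y)) epowr q \<partial>L)
          \<le> D * I epowr (q/p)" .
      have "wnorm q u (\<lambda>y. of_real (w y powr \<beta>) * transform s K f y) \<le> (D * I epowr (q/p)) epowr (1/q)"
        unfolding wnorm_half_line L_def[symmetric] using main pos by (intro epowr_mono) auto
      also have "\<dots> = D epowr (1/q) * I epowr (1/p)"
        using pos by (simp add: epowr_mult epowr_epowr)
      also have "D epowr (1/q) = ennreal (enn2real (D epowr (1/q)))"
        using D by simp
      also have "I epowr (1/p) = wnorm p v (\<lambda>x. of_real (s x powr \<alpha>) * f x)"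
        unfolding wnorm_half_line L_def[symmetric] I_def by (simp add: norm_mult)
      finally show "wnorm q u (\<lambda>y. of_real (w y powr rec_exp a') * transform s K f y)
          \<le> ennreal (enn2real (D epowr (1/q))) * wnorm p v (\<lambda>x. of_real (s x powr rec_exp a) * f x)"
        by (simp add: \<alpha>_def \<beta>_def)
    qed
  qed
qed

end
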